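(* Let $R\subset S$ be a ring extension of length 2. Assume that $|\mathrm{Supp}(S/R)|=2$ and $\mathrm{Supp}(S/R)\not\subseteq\mathrm{Max}(R)$. Then $R\subset S$ is a Prüfer extension, $|[R,S]|=3$ and $R\subset S$ is a simple extension.
   Context: Rings are commutative and unital; $R\subset S$ denotes a proper ring extension and $[R,S]$ the set of all $R$-subalgebras of $S$. The length $\ell[R,S]$ is the supremum of the lengths $n$ of chains $R_0\subset R_1\subset\cdots\subset R_n$ of elements of $[R,S]$; the extension has length 2 if $\ell[R,S]=2$. $\mathrm{Supp}(S/R)=\{P\in\mathrm{Spec}(R)\mid (S/R)_P\neq 0\}$. $R\subseteq S$ is Prüfer if $R\subseteq T$ is a flat epimorphism (in the category of commutative rings) for each $T\in[R,S]$. $R\subset S$ is simple if $S=R[t]$ for some $t\in S$. *)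

theory Defs
  imports "HOL-Algebra.Algebra" "HOL-Library.Extended_Nat"
begin

text \<open>
  An extension \<open>R \<subset> S\<close> is given by a commutative ring \<^term>\<open>S\<close> and the carrier \<^term>\<open>R\<close> of a subring
  of it; a subring \<^term>\<open>T\<close> is regarded as the ring \<^term>\<open>S\<lparr>carrier := T\<rparr>\<close>.
\<close>

section \<open>Intermediate rings\<close>

definition intermediate_rings :: "('a, 'm) ring_scheme \<Rightarrow> 'a set \<Rightarrow> 'a set set" where
  "intermediate_rings S R = {T. subring T S \<and> R \<subseteq> T}"

definition extension_length :: "('a, 'm) ring_scheme \<Rightarrow> 'a set \<Rightarrow> enat" where
  "extension_length S R =
     Sup {enat n | n. \<exists>C. (\<forall>i\<le>n. C i \<in> intermediate_rings S R) \<and> (\<forall>i<n. C i \<subset> C (Suc i))}"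

definition simple_ring_extension :: "('a, 'm) ring_scheme \<Rightarrow> 'a set \<Rightarrow> bool" where
  "simple_ring_extension S R \<longleftrightarrow> (\<exists>t\<in>carrier S. carrier S = ring.simple_extension S R t)"

section \<open>Support of a module\<close>

definition Spec :: "('r, 'm) ring_scheme \<Rightarrow> 'r set set" where
  "Spec A = {P. primeideal P A}"

definition Max_Spec :: "('r, 'm) ring_scheme \<Rightarrow> 'r set set" where
  "Max_Spec A = {P. maximalideal P A}"

text \<open>The ring structure contained in the library's module record plays no role for modules.\<close>

definition ring_as_module :: "('a, 'm) ring_scheme \<Rightarrow> ('a, 'a) module" where
  "ring_as_module B = \<lparr>carrier = carrier B, monoid.mult = (\<otimes>\<^bsub>B\<^esub>), one = \<one>\<^bsub>B\<^esub>,
     ring.zero = \<zero>\<^bsub>B\<^esub>, ring.add = (\<oplus>\<^bsub>B\<^esub>), smult = (\<otimes>\<^bsub>B\<^esub>)\<rparr>"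

definition quotient_module :: "('r, 'a) module \<Rightarrow> 'a set \<Rightarrow> ('r, 'a set) module" where
  "quotient_module M N = \<lparr>carrier = a_rcosets\<^bsub>M\<^esub> N, monoid.mult = undefined, one = undefined,
     ring.zero = N, ring.add = set_add M,
     smult = (\<lambda>r K. \<Union>x\<in>K. N +>\<^bsub>M\<^esub> (r \<odot>\<^bsub>M\<^esub> x))\<rparr>"

definition localization_rel ::
    "'r set \<Rightarrow> ('r, 'a) module \<Rightarrow> (('a \<times> 'r) \<times> ('a \<times> 'r)) set" where
  "localization_rel U M = {((m, s), (n, t)). m \<in> carrier M \<and> n \<in> carrier M \<and> s \<in> U \<and> t \<in> U \<and>
     (\<exists>u\<in>U. u \<odot>\<^bsub>M\<^esub> (t \<odot>\<^bsub>M\<^esub> m) = u \<odot>\<^bsub>M\<^esub> (s \<odot>\<^bsub>M\<^esub> n))}"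

definition module_fraction ::
    "'r set \<Rightarrow> ('r, 'a) module \<Rightarrow> 'a \<Rightarrow> 'r \<Rightarrow> ('a \<times> 'r) set" where
  "module_fraction U M m s = localization_rel U M `` {(m, s)}"

text \<open>
  The module of fractions of \<^term>\<open>M\<close> with denominators in the multiplicative subset \<^term>\<open>U\<close> of \<^term>\<open>A\<close>,
  with its scalars restricted along the canonical map from \<^term>\<open>A\<close> to its ring of fractions.
\<close>

definition localized_module ::
    "('r, 'm) ring_scheme \<Rightarrow> 'r set \<Rightarrow> ('r, 'a) module \<Rightarrow> ('r, ('a \<times> 'r) set) module" where
  "localized_module A U M = \<lparr>carrier = (carrier M \<times> U) // localization_rel U M,
     monoid.mult = undefined, one = undefined,
     ring.zero = module_fraction U M \<zero>\<^bsub>M\<^esub> \<one>\<^bsub>A\<^esub>,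
     ring.add = (\<lambda>K L. \<Union>(m, s)\<in>K. \<Union>(n, t)\<in>L.
       module_fraction U M ((t \<odot>\<^bsub>M\<^esub> m) \<oplus>\<^bsub>M\<^esub> (s \<odot>\<^bsub>M\<^esub> n)) (s \<otimes>\<^bsub>A\<^esub> t)),
     smult = (\<lambda>r K. \<Union>(m, s)\<in>K. module_fraction U M (r \<odot>\<^bsub>M\<^esub> m) s)\<rparr>"

definition module_support :: "('r, 'm) ring_scheme \<Rightarrow> ('r, 'a) module \<Rightarrow> 'r set set" where
  "module_support A M = {P \<in> Spec A.
     carrier (localized_module A (carrier A - P) M) \<noteq> {\<zero>\<^bsub>localized_module A (carrier A - P) M\<^esub>}}"

definition extension_support :: "('a, 'm) ring_scheme \<Rightarrow> 'a set \<Rightarrow> 'a set set" where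
  "extension_support S R =
     module_support (S\<lparr>carrier := R\<rparr>) (quotient_module (ring_as_module S) R)"

section \<open>Tensor products and flatness\<close>

definition module_homs ::
    "('r, 'm) ring_scheme \<Rightarrow> ('r, 'a) module \<Rightarrow> ('r, 'b) module \<Rightarrow> ('a \<Rightarrow> 'b) set" where
  "module_homs A M N = {f \<in> carrier M \<rightarrow> carrier N.
     (\<forall>x\<in>carrier M. \<forall>y\<in>carrier M. f (x \<oplus>\<^bsub>M\<^esub> y) = f x \<oplus>\<^bsub>N\<^esub> f y) \<and>
     (\<forall>a\<in>carrier A. \<forall>x\<in>carrier M. f (a \<odot>\<^bsub>M\<^esub> x) = a \<odot>\<^bsub>N\<^esub> f x)}"

definition tensor_relators ::
    "('r, 'm) ring_scheme \<Rightarrow> ('r, 'a) module \<Rightarrow> ('r, 'b) module \<Rightarrow> ('a \<times> 'b \<Rightarrow>\<^sub>0 int) set" where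
  "tensor_relators A M N =
     {frag_of (x \<oplus>\<^bsub>M\<^esub> x', y) - frag_of (x, y) - frag_of (x', y) | x x' y.
        x \<in> carrier M \<and> x' \<in> carrier M \<and> y \<in> carrier N} \<union>
     {frag_of (x, y \<oplus>\<^bsub>N\<^esub> y') - frag_of (x, y) - frag_of (x, y') | x y y'.
        x \<in> carrier M \<and> y \<in> carrier N \<and> y' \<in> carrier N} \<union>
     {frag_of (a \<odot>\<^bsub>M\<^esub> x, y) - frag_of (x, a \<odot>\<^bsub>N\<^esub> y) | a x y.
        a \<in> carrier A \<and> x \<in> carrier M \<and> y \<in> carrier N}"

definition tensor_kernel ::
    "('r, 'm) ring_scheme \<Rightarrow> ('r, 'a) module \<Rightarrow> ('r, 'b) module \<Rightarrow> ('a \<times> 'b \<Rightarrow>\<^sub>0 int) set" where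
  "tensor_kernel A M N =
     generate (free_Abelian_group (carrier M \<times> carrier N)) (tensor_relators A M N)"

text \<open>
  The abelian group underlying \<open>M \<otimes>\<^sub>A N\<close>, in the library's multiplicative notation for groups.
\<close>

definition tensor_product ::
    "('r, 'm) ring_scheme \<Rightarrow> ('r, 'a) module \<Rightarrow> ('r, 'b) module \<Rightarrow> ('a \<times> 'b \<Rightarrow>\<^sub>0 int) set monoid"
  where
  "tensor_product A M N =
     free_Abelian_group (carrier M \<times> carrier N) Mod tensor_kernel A M N"

text \<open>The map \<open>f \<otimes> id\<^sub>N\<close> from \<open>M \<otimes>\<^sub>A N\<close> to \<open>M' \<otimes>\<^sub>A N\<close>, on cosets.\<close>

definition tensor_map ::
    "('r, 'm) ring_scheme \<Rightarrow> ('r, 'b) module \<Rightarrow> ('r, 'c) module \<Rightarrow> ('a \<Rightarrow> 'b)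
      \<Rightarrow> ('a \<times> 'c \<Rightarrow>\<^sub>0 int) set \<Rightarrow> ('b \<times> 'c \<Rightarrow>\<^sub>0 int) set" where
  "tensor_map A M' N f K =
     (\<Union>c\<in>K. tensor_kernel A M' N #>\<^bsub>free_Abelian_group (carrier M' \<times> carrier N)\<^esub>
               frag_extend (\<lambda>(x, y). frag_of (f x, y)) c)"

text \<open>
  HOL cannot quantify over all types inside a definition, so the test modules and test rings below
  have their elements in a type \<open>'u\<close> named by the first argument. A theorem in which \<open>'u\<close> is
  a free type variable asserts the property for all test objects.
\<close>

definition flat_module :: "'u itself \<Rightarrow> ('r, 'm) ring_scheme \<Rightarrow> ('r, 'a) module \<Rightarrow> bool" where
  "flat_module _ A N \<longleftrightarrow> module A N \<and>
     (\<forall>(M :: ('r, 'u) module) (M' :: ('r, 'u) module) f.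
        module A M \<and> module A M' \<and> f \<in> module_homs A M M' \<and> inj_on f (carrier M) \<longrightarrow>
        inj_on (tensor_map A M' N f) (carrier (tensor_product A M N)))"

definition cring_epimorphism ::
    "'u itself \<Rightarrow> ('a, 'm) ring_scheme \<Rightarrow> ('b, 'n) ring_scheme \<Rightarrow> ('a \<Rightarrow> 'b) \<Rightarrow> bool" where
  "cring_epimorphism _ A B h \<longleftrightarrow> h \<in> ring_hom A B \<and>
     (\<forall>(C :: 'u ring) f g.
        cring C \<and> f \<in> ring_hom B C \<and> g \<in> ring_hom B C \<and>
        (\<forall>x\<in>carrier A. f (h x) = g (h x)) \<longrightarrow>
        (\<forall>y\<in>carrier B. f y = g y))"

definition pruefer_extension :: "'u itself \<Rightarrow> ('a, 'm) ring_scheme \<Rightarrow> 'a set \<Rightarrow> bool" where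
  "pruefer_extension U S R \<longleftrightarrow> (\<forall>T\<in>intermediate_rings S R.
     flat_module U (S\<lparr>carrier := R\<rparr>) (ring_as_module (S\<lparr>carrier := T\<rparr>)) \<and>
     cring_epimorphism U (S\<lparr>carrier := R\<rparr>) (S\<lparr>carrier := T\<rparr>) (\<lambda>x. x))"

end

theory Submission
  imports Defs
begin

text \<open>
  Let \<open>P\<close> be a non-maximal prime in the support and \<open>m \<notin> P\<close> with \<open>P + mR \<noteq> R\<close>. Let \<open>T\<close> be the
  ring of all \<open>t \<in> S\<close> whose denominator ideal \<open>(R : t)\<close> is not contained in \<open>P\<close>.

  The key point is that a ring \<open>A\<close> with \<open>A \<subset> B\<close> of finite length cannot be saturated in \<open>B\<close> with
  respect to some \<open>a \<in> A\<close> and all \<open>1 - ay\<close>: the chain of the \<open>A[a\<^sup>nx]\<close> becomes stationary, so after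
  replacing \<open>x\<close> by some \<open>a\<^sup>nx\<close> one has \<open>A[x] = A + aA[x]\<close>. For integral \<open>x\<close> Nakayama's lemma
  then gives \<open>x \<in> A\<close>. So \<open>A\<close> is integrally closed in \<open>B\<close>, and because the chain of the
  \<open>A[x\<^bsup>2^k\<^esup>]\<close> becomes stationary too, every \<open>x\<close> is a root of a polynomial with a unit coefficient;
  this forces \<open>(A : x)A[x] = A[x]\<close>. Hence \<open>1 = d + aw\<close> with \<open>d \<in> (A : x)\<close>, \<open>w \<in> A\<close>, and again
  \<open>x \<in> A\<close>.

  With \<open>a = m\<close> this shows that every ring strictly above \<open>R\<close> meets \<open>T\<close> outside \<open>R\<close>, and length 2
  leaves only \<open>R\<close>, \<open>T\<close>, \<open>S\<close>. An integral element outside \<open>R\<close> would generate \<open>T\<close>, and the same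
  argument over \<open>T\<close> with \<open>a\<close> a multiple of \<open>m\<close> in the conductor gives \<open>T = S\<close>, a contradiction. So
  \<open>R\<close> is integrally closed in \<open>S\<close>, and \<open>(R : t)R[t] = R[t]\<close> for all \<open>t\<close> makes all intermediate
  rings flat epimorphic over \<open>R\<close>.
\<close>

section \<open>Polynomial values and integral elements\<close>

context cring
begin

text \<open>Elements of \<open>A[x]\<close> are built by Horner steps, so each closure property is
  an induction on these. Products come after the other operations because their step uses sums,
  scalars and multiplication by \<open>x\<close>.\<close>

lemma simple_extension_subring:
  assumes A: "subring A R" and x: "x \<in> carrier R"
  shows "subring (simple_extension A x) R"
proof -
  note A' = subringE[OF A]
  note carr = subsetD[OF A'(1)] subsetD[OF simple_extension_in_carrier[OF A'(1) x]]
  have scalar: "c \<otimes> y \<in> simple_extension A x" if "y \<in> simple_extension A x" "c \<in> A" for c y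
    using that
  proof (induction)
    case zero
    then show ?case using carr by simp
  next
    case (lin y k)
    have "c \<otimes> (y \<otimes> x \<oplus> k) = (c \<otimes> y) \<otimes> x \<oplus> c \<otimes> k"
      using lin carr x by algebra
    then show ?case using lin A'(6) by (simp add: simple_extension.lin)
  qed
  have add: "y \<oplus> z \<in> simple_extension A x"
    if "y \<in> simple_extension A x" "z \<in> simple_extension A x" for y z
    using that
  proof (induction arbitrary: z)
    case zero
    then show ?case using carr by simp
  next
    case (lin y k)
    from lin.prems show ?case
    proof (cases)
      case zero
      then show ?thesis using lin carr x by (simp add: simple_extension.lin)
    next
      case (lin z' k')
      have "y \<otimes> x \<oplus> k \<oplus> (z' \<otimes> x \<oplus> k') = (y \<oplus> z') \<otimes> x \<oplus> (k \<oplus> k')"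
        using lin \<open>y \<in> _\<close> \<open>k \<in> A\<close> carr x by algebra
      then show ?thesis
        using lin \<open>k \<in> A\<close> lin.IH A'(7) \<open>\<And>z. z \<in> simple_extension A x \<Longrightarrow> y \<oplus> z \<in> _\<close>
        by (simp add: simple_extension.lin)
    qed
  qed
  have mult_x: "y \<otimes> x \<in> simple_extension A x" if "y \<in> simple_extension A x" for y
    using simple_extension.lin[OF that A'(2)] carr that x by simp
  have mult: "y \<otimes> z \<in> simple_extension A x"
    if "y \<in> simple_extension A x" "z \<in> simple_extension A x" for y z
    using that
  proof (induction)
    case zero
    then show ?case using carr by simp
  next
    case (lin y k)
    have "(y \<otimes> x \<oplus> k) \<otimes> z = (y \<otimes> z) \<otimes> x \<oplus> k \<otimes> z"
      using lin carr x by algebra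
    then show ?case using lin add scalar mult_x by simp
  qed
  have "\<ominus> y \<in> simple_extension A x" if "y \<in> simple_extension A x" for y
  proof -
    have "\<ominus> y = (\<ominus> \<one>) \<otimes> y" using carr(2)[OF that] by algebra
    then show ?thesis using scalar[OF that A'(5)[OF A'(3)]] by metis
  qed
  then show ?thesis
    using simple_extension_in_carrier[OF A'(1) x] simple_extension_incl[OF A'(1) x] A'(3) mult add
    by (intro subringI) auto
qed

text \<open>The last Horner step of \<open>z\<close> is \<open>y (a x) + k\<close> with
  \<open>y\<close> in \<open>A[ax]\<close>, a subring of \<open>A[x]\<close>. Hence
  \<open>A[ax]\<close> lies in \<open>A + a A[x]\<close>, which is how a stationary chain yields
  \<open>A[x] = A + a A[x]\<close>.\<close>

lemma simple_extension_mult_subset: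
  assumes A: "subring A R" and a: "a \<in> A" and x: "x \<in> carrier R"
    and z: "z \<in> simple_extension A (a \<otimes> x)"
  shows "\<exists>r\<in>A. \<exists>w\<in>simple_extension A x. z = r \<oplus> a \<otimes> w"
  using z
proof cases
  note A' = subringE[OF A]
  note carr = subsetD[OF A'(1)] subsetD[OF simple_extension_in_carrier[OF A'(1) x]]
  note B = subringE[OF simple_extension_subring[OF A x]]
  {
    case zero
    then show ?thesis
      using A'(2) a carr by (intro bexI[of _ \<zero>]) auto
  next
    case (lin y k)
    have ax: "a \<otimes> x \<in> simple_extension A x"
      using B(6) a simple_extension_incl[OF A'(1) x] simple_extension_mem[OF A x] by auto
    have "simple_extension A (a \<otimes> x) \<subseteq> simple_extension A x"
      by (rule simple_extension_subring_incl[OF simple_extension_subring[OF A x]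
            simple_extension_incl[OF A'(1) x] ax])
    then have y: "y \<in> simple_extension A x" using lin by auto
    have "z = k \<oplus> a \<otimes> (y \<otimes> x)"
      using lin a y carr x by algebra
    then show ?thesis
      using lin y B(6) simple_extension_mem[OF A x] by blast
  }
qed

text \<open>The \<open>A\<close>-span of \<open>1, x, ..., x^(n-1)\<close>. The list starts with the
  top coefficient, and leading zeros are allowed, so the spans grow with \<open>n\<close>.\<close>

definition poly_values :: "'a set \<Rightarrow> 'a \<Rightarrow> nat \<Rightarrow> 'a set" where
  "poly_values A x n = {eval p x | p. set p \<subseteq> A \<and> length p = n}"

lemma poly_values_0 [simp]: "poly_values A x 0 = {\<zero>}"
  by (auto simp: poly_values_def)

lemma poly_values_Suc:
  "poly_values A x (Suc n) = {c \<otimes> x [^] n \<oplus> f | c f. c \<in> A \<and> f \<in> poly_values A x n}"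
proof -
  have "\<exists>c f. eval p x = c \<otimes> x [^] n \<oplus> f \<and> c \<in> A \<and> f \<in> poly_values A x n"
    if "set p \<subseteq> A" "length p = Suc n" for p
    using that by (cases p) (auto simp: poly_values_def)
  moreover have "c \<otimes> x [^] n \<oplus> eval p x \<in> poly_values A x (Suc n)"
    if "c \<in> A" "set p \<subseteq> A" "length p = n" for c p
    using that by (auto simp: poly_values_def intro!: exI[of _ "c # p"])
  ultimately show ?thesis
    unfolding set_eq_iff by (auto simp: poly_values_def)
qed

lemma poly_values_SucI:
  assumes "y = c \<otimes> x [^] n \<oplus> f" "c \<in> A" "f \<in> poly_values A x n"
  shows "y \<in> poly_values A x (Suc n)"
  using assms by (auto simp: poly_values_Suc)

lemma poly_values_carrier:
  assumes "A \<subseteq> carrier R" "x \<in> carrier R"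
  shows "poly_values A x n \<subseteq> carrier R"
  using assms eval_in_carrier[of _ x] by (auto simp: poly_values_def)

lemma poly_values_smult:
  assumes A: "subring A R" and x: "x \<in> carrier R" and c: "c \<in> A" and f: "f \<in> poly_values A x n"
  shows "c \<otimes> f \<in> poly_values A x n"
  using f
proof (induction n arbitrary: f)
  case 0
  then show ?case using c subsetD[OF subringE(1)[OF A]] by simp
next
  case (Suc n)
  note A' = subringE[OF A]
  note carr = subsetD[OF A'(1)] subsetD[OF poly_values_carrier[OF A'(1) x]]
  from Suc.prems obtain d g where dg: "f = d \<otimes> x [^] n \<oplus> g" "d \<in> A" "g \<in> poly_values A x n"
    by (auto simp: poly_values_Suc)
  have "x [^] n \<in> carrier R" using x by simp
  then have "c \<otimes> f = (c \<otimes> d) \<otimes> x [^] n \<oplus> c \<otimes> g"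
    using dg c carr by algebra
  then show ?case using dg c A'(6) Suc.IH by (blast intro: poly_values_SucI)
qed

lemma poly_values_add:
  assumes A: "subring A R" and x: "x \<in> carrier R"
    and "f \<in> poly_values A x n" "g \<in> poly_values A x n"
  shows "f \<oplus> g \<in> poly_values A x n"
  using assms(3,4)
proof (induction n arbitrary: f g)
  case 0
  then show ?case by simp
next
  case (Suc n)
  note A' = subringE[OF A]
  note carr = subsetD[OF A'(1)] subsetD[OF poly_values_carrier[OF A'(1) x]]
  from Suc.prems obtain d f' e g' where
    dg: "f = d \<otimes> x [^] n \<oplus> f'" "d \<in> A" "f' \<in> poly_values A x n"
        "g = e \<otimes> x [^] n \<oplus> g'" "e \<in> A" "g' \<in> poly_values A x n"
    by (auto simp: poly_values_Suc)
  have "x [^] n \<in> carrier R" using x by simp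
  then have "f \<oplus> g = (d \<oplus> e) \<otimes> x [^] n \<oplus> (f' \<oplus> g')"
    using dg carr by algebra
  then show ?case using dg A'(7) Suc.IH by (blast intro: poly_values_SucI)
qed

lemma poly_values_mono_Suc:
  assumes A: "subring A R" and x: "x \<in> carrier R" and f: "f \<in> poly_values A x n"
  shows "f \<in> poly_values A x (Suc n)"
proof -
  note A' = subringE[OF A]
  have "f = \<zero> \<otimes> x [^] n \<oplus> f"
    using f subsetD[OF poly_values_carrier[OF A'(1) x]] x by simp
  then show ?thesis using f A'(2) by (blast intro: poly_values_SucI)
qed

lemma poly_values_shift:
  assumes A: "subring A R" and x: "x \<in> carrier R" and f: "f \<in> poly_values A x n"
  shows "f \<otimes> x \<in> poly_values A x (Suc n)"
  using f
proof (induction n arbitrary: f)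
  case 0
  then show ?case
    using subringE(2)[OF A] x by (intro poly_values_SucI[of _ \<zero> _ _ \<zero>]) auto
next
  case (Suc n)
  note A' = subringE[OF A]
  note carr = subsetD[OF A'(1)] subsetD[OF poly_values_carrier[OF A'(1) x]]
  from Suc.prems obtain d g where dg: "f = d \<otimes> x [^] n \<oplus> g" "d \<in> A" "g \<in> poly_values A x n"
    by (auto simp: poly_values_Suc)
  have "x [^] n \<in> carrier R" using x by simp
  then have "f \<otimes> x = d \<otimes> x [^] Suc n \<oplus> g \<otimes> x"
    unfolding nat_pow_Suc using dg carr x by algebra
  then show ?case using dg Suc.IH by (blast intro: poly_values_SucI)
qed

lemma poly_values_const:
  assumes A: "subring A R" and x: "x \<in> carrier R" and k: "k \<in> A"
  shows "k \<in> poly_values A x (Suc n)"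
proof (induction n)
  case 0
  have "k = k \<otimes> x [^] (0::nat) \<oplus> \<zero>" using k subsetD[OF subringE(1)[OF A]] by simp
  then show ?case using k by (auto intro: poly_values_SucI)
next
  case (Suc n)
  then show ?case by (rule poly_values_mono_Suc[OF A x])
qed

lemma poly_values_monom:
  assumes A: "subring A R" and x: "x \<in> carrier R" and k: "k \<in> A"
  shows "k \<otimes> x [^] n \<in> poly_values A x (Suc n)"
proof (rule poly_values_SucI)
  show "k \<otimes> x [^] n = k \<otimes> x [^] n \<oplus> \<zero>"
    using k x subsetD[OF subringE(1)[OF A]] by simp
  show "\<zero> \<in> poly_values A x n"
    using poly_values_const[OF A x subringE(2)[OF A]] by (cases n) auto
qed (rule k)

text \<open>
  A monic relation for \<open>x\<close> becomes one for \<open>c \<otimes> x\<close> after multiplication by a power of \<open>c\<close>; the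
  leading coefficient \<open>c\<close> itself provides one factor, hence the exponent \<open>n - 1\<close>.
\<close>

lemma poly_values_scale:
  assumes A: "subring A R" and x: "x \<in> carrier R" and c: "c \<in> A" and f: "f \<in> poly_values A x n"
    and j: "n \<le> Suc j"
  shows "c [^] j \<otimes> f \<in> poly_values A (c \<otimes> x) n"
  using f j
proof (induction n arbitrary: f j)
  case 0
  then show ?case using c subsetD[OF subringE(1)[OF A]] by simp
next
  case (Suc n)
  note A' = subringE[OF A]
  note carr = subsetD[OF A'(1)] subsetD[OF poly_values_carrier[OF A'(1) x]]
  from Suc.prems obtain d g where dg: "f = d \<otimes> x [^] n \<oplus> g" "d \<in> A" "g \<in> poly_values A x n"
    by (auto simp: poly_values_Suc)
  have cpow: "c [^] k \<in> A" for k :: nat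
    using c by (induction k) (auto simp: A')
  obtain i where i: "j = n + i" using Suc.prems by (auto simp: le_iff_add)
  have IH: "c [^] j \<otimes> g \<in> poly_values A (c \<otimes> x) n"
    using Suc.IH[OF dg(3), of j] Suc.prems by simp
  have "x [^] n \<in> carrier R" "c [^] i \<in> carrier R" "c [^] n \<in> carrier R" using x c carr by auto
  moreover have "c [^] j = c [^] n \<otimes> c [^] i"
    using i c carr by (simp add: nat_pow_mult)
  ultimately have "c [^] j \<otimes> f = (c [^] i \<otimes> d) \<otimes> (c [^] n \<otimes> x [^] n) \<oplus> c [^] j \<otimes> g"
    using dg carr by simp algebra
  moreover have "c [^] n \<otimes> x [^] n = (c \<otimes> x) [^] n"
    using c x carr by (simp add: nat_pow_distrib)
  ultimately show ?case
    using IH dg(2) cpow A'(6) by (auto intro: poly_values_SucI)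
qed

text \<open>A monic relation of degree \<open>n\<close>. For \<open>n = 0\<close> it says 1 = 0,
  which happens only in the zero ring.\<close>

definition integral_over :: "'a set \<Rightarrow> 'a \<Rightarrow> bool" where
  "integral_over A x \<longleftrightarrow> (\<exists>n. x [^] n \<in> poly_values A x n)"

text \<open>Multiplication by \<open>c [^] n\<close> turns the relation into a monic one for
  \<open>c \<otimes> x\<close>.\<close>

lemma leading_coeff_mult_integral:
  assumes A: "subring A R" and x: "x \<in> carrier R" and c: "c \<in> A"
    and rel: "c \<otimes> x [^] Suc n \<in> poly_values A x (Suc n)"
  shows "integral_over A (c \<otimes> x)"
proof -
  have cc: "c \<in> carrier R" using c subringE(1)[OF A] by auto
  have "c [^] n \<otimes> (c \<otimes> x [^] Suc n) \<in> poly_values A (c \<otimes> x) (Suc n)"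
    by (rule poly_values_scale[OF A x c rel]) simp
  moreover have "c [^] n \<otimes> (c \<otimes> x [^] Suc n) = (c [^] Suc n) \<otimes> (x [^] Suc n)"
    using cc x nat_pow_closed[OF cc, of n] nat_pow_closed[OF x, of n]
    unfolding nat_pow_Suc by algebra
  moreover have "\<dots> = (c \<otimes> x) [^] Suc n"
    by (rule nat_pow_distrib[OF cc x, symmetric])
  ultimately show ?thesis
    unfolding integral_over_def by metis
qed

text \<open>Multiplying the monic relation of \<open>x\<close> by \<open>c \<otimes> x\<close> gives
  one of positive degree with leading coefficient \<open>c\<close>, the shape treated above.\<close>

lemma integral_over_mult:
  assumes A: "subring A R" and x: "x \<in> carrier R" and c: "c \<in> A" and int: "integral_over A x"
  shows "integral_over A (c \<otimes> x)"
proof -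
  obtain n where "x [^] n \<in> poly_values A x n" using int by (auto simp: integral_over_def)
  then have "c \<otimes> x [^] Suc n \<in> poly_values A x (Suc n)"
    using poly_values_smult[OF A x c] poly_values_shift[OF A x] by simp
  then show ?thesis by (rule leading_coeff_mult_integral[OF A x c])
qed

text \<open>A Horner step raises the degree by at most one, and one more factor \<open>u\<close>
  brings the new top term \<open>x [^] n\<close> back below degree \<open>n\<close>.\<close>

lemma leading_coeff_clears:
  assumes A: "subring A R" and x: "x \<in> carrier R" and u: "u \<in> A"
    and rel: "u \<otimes> x [^] n \<in> poly_values A x n" and w: "w \<in> simple_extension A x"
  shows "\<exists>j::nat. u [^] j \<otimes> w \<in> poly_values A x n"
  using w
proof induction
  case zero
  have "\<zero> \<in> poly_values A x n"
    using poly_values_smult[OF A x subringE(2)[OF A] rel] u x subringE(1)[OF A] by auto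
  then show ?case using u subringE(1)[OF A] by (intro exI[of _ 0]) simp
next
  case (lin w k)
  note A' = subringE[OF A]
  note carr = subsetD[OF A'(1)] subsetD[OF poly_values_carrier[OF A'(1) x]]
    subsetD[OF simple_extension_in_carrier[OF A'(1) x]]
  have upow: "u [^] i \<in> A" for i :: nat
    using u by (induction i) (auto simp: A')
  have reduce: "u \<otimes> f \<in> poly_values A x n" if "f \<in> poly_values A x (Suc n)" for f
  proof -
    from that obtain d g where dg: "f = d \<otimes> x [^] n \<oplus> g" "d \<in> A" "g \<in> poly_values A x n"
      by (auto simp: poly_values_Suc)
    have "x [^] n \<in> carrier R" using x by simp
    then have "u \<otimes> f = d \<otimes> (u \<otimes> x [^] n) \<oplus> u \<otimes> g"
      using dg u carr by algebra
    then show ?thesis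
      using poly_values_add[OF A x] poly_values_smult[OF A x] rel u dg by simp
  qed
  obtain j :: nat where j: "u [^] j \<otimes> w \<in> poly_values A x n" using lin by auto
  have "u [^] j \<otimes> (w \<otimes> x \<oplus> k) = (u [^] j \<otimes> w) \<otimes> x \<oplus> u [^] j \<otimes> k"
    using carr(1)[OF upow] lin carr x by algebra
  moreover have "u [^] j \<otimes> k \<in> poly_values A x (Suc n)"
    using poly_values_const[OF A x] upow lin A'(6) by simp
  ultimately have "u [^] j \<otimes> (w \<otimes> x \<oplus> k) \<in> poly_values A x (Suc n)"
    using poly_values_add[OF A x] poly_values_shift[OF A x j] by simp
  from reduce[OF this] have "u [^] Suc j \<otimes> (w \<otimes> x \<oplus> k) \<in> poly_values A x n"
    using carr(1)[OF upow] lin carr x u by (simp add: m_ac)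
  then show ?case by blast
qed

lemma integral_simple_extension:
  assumes A: "subring A R" and x: "x \<in> carrier R"
    and rel: "x [^] n \<in> poly_values A x n"
  shows "simple_extension A x \<subseteq> poly_values A x n"
proof
  fix w assume w: "w \<in> simple_extension A x"
  then have "w \<in> carrier R"
    using simple_extension_in_carrier[OF subringE(1)[OF A] x] by auto
  then show "w \<in> poly_values A x n"
    using leading_coeff_clears[OF A x subringE(3)[OF A] _ w, of n] rel x by simp
qed

text \<open>
  Nakayama's lemma for the finite module \<open>A[x]/A\<close>: in a relation of least degree whose leading
  coefficient lies in \<open>1 + aA\<close>, a degree above \<open>1\<close> can be lowered using \<open>x \<in> A + aA[x]\<close>.
\<close>

lemma cyclic_nakayama:
  assumes A: "subring A R" and x: "x \<in> carrier R" and a: "a \<in> A"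
    and int: "integral_over A x"
    and r: "r \<in> A" and w: "w \<in> simple_extension A x" and xrw: "x = r \<oplus> a \<otimes> w"
  shows "\<exists>y\<in>A. (\<one> \<ominus> a \<otimes> y) \<otimes> x \<in> A"
proof -
  note A' = subringE[OF A]
  note carr = subsetD[OF A'(1)] subsetD[OF poly_values_carrier[OF A'(1) x]]
    subsetD[OF simple_extension_in_carrier[OF A'(1) x]]
  \<comment> \<open>The coset \<open>1 + aA\<close> is closed under products, so clearing with
    powers of \<open>u\<close> does not leave it.\<close>
  define U where "U = {\<one> \<ominus> a \<otimes> y | y. y \<in> A}"
  have UA: "U \<subseteq> A" using A' a by (auto simp: U_def a_minus_def)
  have U1: "\<one> \<in> U"
    unfolding U_def using A'(2) carr a by (auto simp: a_minus_def intro!: exI[of _ \<zero>])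
  have Umult: "u \<otimes> v \<in> U" if uv: "u \<in> U" "v \<in> U" for u v
  proof -
    obtain y z where yz: "u = \<one> \<ominus> a \<otimes> y" "v = \<one> \<ominus> a \<otimes> z" "y \<in> A" "z \<in> A"
      using uv by (auto simp: U_def)
    have "u \<otimes> v = \<one> \<ominus> a \<otimes> (y \<oplus> z \<ominus> a \<otimes> y \<otimes> z)"
      using yz carr a by algebra
    moreover have "y \<oplus> z \<ominus> a \<otimes> y \<otimes> z \<in> A"
      using yz a A' by (simp add: a_minus_def)
    ultimately show ?thesis by (auto simp: U_def)
  qed
  have Upow: "u [^] j \<in> U" if "u \<in> U" for u and j :: nat
    using U1 Umult that by (induction j) auto
  define deg where "deg n \<longleftrightarrow> (\<exists>u\<in>U. u \<otimes> x [^] n \<in> poly_values A x n)" for n :: nat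
  have "\<exists>n. deg n"
    using int U1 x by (auto simp: deg_def integral_over_def intro!: bexI[of _ \<one>])
  then have L: "deg (LEAST n. deg n)" by (rule LeastI_ex)
  define n where "n = (LEAST n. deg n)"
  obtain u where u: "u \<in> U" "u \<otimes> x [^] n \<in> poly_values A x n"
    using L by (auto simp: deg_def n_def)
  have "n < 2"
  proof (rule ccontr)
    assume "\<not> n < 2"
    then obtain m where m: "n = Suc (Suc m)"
      by (metis add_2_eq_Suc le_add_diff_inverse not_less)
    have xm: "x [^] m \<in> simple_extension A x"
      using subringE(3,6)[OF simple_extension_subring[OF A x]] simple_extension_mem[OF A x]
      by (induction m) auto
    \<comment> \<open>Multiplying \<open>x = r + a w\<close> by \<open>x^m\<close> expresses
      \<open>x^(m+1)\<close>; a power \<open>v\<close> of \<open>u\<close> brings the term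
      \<open>w x^m\<close> below degree \<open>n = m + 2\<close>.\<close>
    have "w \<otimes> x [^] m \<in> simple_extension A x"
      using subringE(6)[OF simple_extension_subring[OF A x]] w xm by simp
    from leading_coeff_clears[OF A x _ u(2) this] u(1) UA
    obtain j :: nat where j: "u [^] j \<otimes> (w \<otimes> x [^] m) \<in> poly_values A x n"
      by auto
    define v where "v = u [^] j"
    have v: "v \<in> U" using Upow u(1) by (simp add: v_def)
    from j obtain c f where cf: "v \<otimes> (w \<otimes> x [^] m) = c \<otimes> x [^] Suc m \<oplus> f"
        "c \<in> A" "f \<in> poly_values A x (Suc m)"
      unfolding m v_def[symmetric] by (subst (asm) (2) poly_values_Suc) auto
    obtain y where y: "v = \<one> \<ominus> a \<otimes> y" "y \<in> A" using v by (auto simp: U_def)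
    have xc: "x [^] m \<in> carrier R" "x [^] Suc m \<in> carrier R" using x by auto
    have vc: "v \<in> carrier R" using v UA carr by auto
    have "x [^] Suc m = x [^] m \<otimes> (r \<oplus> a \<otimes> w)" using xrw by simp
    then have e1: "v \<otimes> x [^] Suc m = (v \<otimes> r) \<otimes> x [^] m \<oplus> a \<otimes> (v \<otimes> (w \<otimes> x [^] m))"
      using xc(1) vc r a w carr by algebra
    have e2: "(v \<ominus> a \<otimes> c) \<otimes> x [^] Suc m = v \<otimes> x [^] Suc m \<ominus> a \<otimes> (c \<otimes> x [^] Suc m)"
      using xc vc a cf carr by algebra
    \<comment> \<open>The top term \<open>c x^(m+1)\<close> of \<open>v w x^m\<close> has moved to
      the left-hand side. There \<open>v - a c\<close> still belongs to \<open>U\<close>, against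
      the minimality of \<open>n\<close>.\<close>
    have "(v \<ominus> a \<otimes> c) \<otimes> x [^] Suc m = (v \<otimes> r) \<otimes> x [^] m \<oplus> a \<otimes> f"
      unfolding e2 e1 cf(1) using xc vc a cf(2,3) r carr by algebra
    moreover have "(v \<otimes> r) \<otimes> x [^] m \<oplus> a \<otimes> f \<in> poly_values A x (Suc m)"
      using v UA r a A'(6) cf(3)
      by (intro poly_values_add[OF A x] poly_values_monom[OF A x] poly_values_smult[OF A x]) auto
    moreover have "v \<ominus> a \<otimes> c = \<one> \<ominus> a \<otimes> (y \<oplus> c)"
      using y cf a carr by algebra
    then have "v \<ominus> a \<otimes> c \<in> U" using y cf A'(7) by (auto simp: U_def)
    ultimately have "deg (Suc m)" unfolding deg_def by metis
    then have "n \<le> Suc m" unfolding n_def by (rule Least_le)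
    then show False using m by simp
  qed
  then consider "n = 0" | "n = 1" by linarith
  then have "u \<otimes> x \<in> A"
  proof cases
    \<comment> \<open>In degree 0 the relation reads \<open>u = 0\<close>.\<close>
    case 1
    then have "u = \<zero>" using u UA carr by auto
    then show ?thesis using x A'(2) by simp
  next
    case 2
    then obtain c where "u \<otimes> x = c \<otimes> x [^] (0::nat) \<oplus> \<zero>" "c \<in> A"
      using u x by (auto simp: poly_values_Suc)
    then show ?thesis using carr by simp
  qed
  then show ?thesis using u by (auto simp: U_def)
qed

end

section \<open>Extensions of finite length\<close>

definition denominators :: "('a, 'm) ring_scheme \<Rightarrow> 'a set \<Rightarrow> 'a set \<Rightarrow> 'a set" where
  "denominators S A E = {b \<in> A. \<forall>t\<in>E. b \<otimes>\<^bsub>S\<^esub> t \<in> A}"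

lemma chain_le_extension_length:
  assumes "\<And>i. i \<le> n \<Longrightarrow> C i \<in> intermediate_rings S R" "\<And>i. i < n \<Longrightarrow> C i \<subset> C (Suc i)"
  shows "enat n \<le> extension_length S R"
  unfolding extension_length_def using assms by (intro Sup_upper) blast

lemma extension_length_antimono:
  assumes "R \<subseteq> R'"
  shows "extension_length S R' \<le> extension_length S R"
  unfolding extension_length_def
proof (rule Sup_subset_mono)
  have "intermediate_rings S R' \<subseteq> intermediate_rings S R"
    using assms by (auto simp: intermediate_rings_def)
  then show "{enat n |n. \<exists>C. (\<forall>i\<le>n. C i \<in> intermediate_rings S R') \<and> (\<forall>i<n. C i \<subset> C (Suc i))}
    \<subseteq> {enat n |n. \<exists>C. (\<forall>i\<le>n. C i \<in> intermediate_rings S R) \<and> (\<forall>i<n. C i \<subset> C (Suc i))}"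
    by blast
qed

text \<open>Initial pieces of a strictly descending sequence, read backwards, would be ascending
  chains of every length.\<close>

lemma finite_length_dcc:
  assumes fin: "extension_length S R \<noteq> \<infinity>"
    and C: "\<And>n. C n \<in> intermediate_rings S R" "\<And>n. C (Suc n) \<subseteq> C n"
  shows "\<exists>n. C (Suc n) = C n"
proof (rule ccontr)
  assume "\<nexists>n. C (Suc n) = C n"
  then have strict: "C (Suc n) \<subset> C n" for n using C(2)[of n] by blast
  have "enat n \<le> extension_length S R" for n
  proof (rule chain_le_extension_length)
    show "C (n - i) \<subset> C (n - Suc i)" if "i < n" for i
      using strict[of "n - Suc i"] that by (simp add: Suc_diff_Suc)
  qed (rule C)
  moreover obtain l where "extension_length S R = enat l" using fin by auto
  ultimately have "enat (Suc l) \<le> enat l" by metis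
  then show False by simp
qed

context cring
begin

lemma ideal_of_subringI:
  assumes B: "subring B R" and J: "J \<subseteq> B" "\<zero> \<in> J"
    and add: "\<And>u v. u \<in> J \<Longrightarrow> v \<in> J \<Longrightarrow> u \<oplus> v \<in> J"
    and mult: "\<And>b u. b \<in> B \<Longrightarrow> u \<in> J \<Longrightarrow> b \<otimes> u \<in> J"
  shows "ideal J (R\<lparr>carrier := B\<rparr>)"
proof -
  note B' = subringE[OF B]
  interpret B: ring "R\<lparr>carrier := B\<rparr>" by (rule subring_is_ring[OF B])
  have neg: "\<ominus> u \<in> J" if "u \<in> J" for u
  proof -
    have "u \<in> carrier R" using that J B' by auto
    then have "\<ominus> u = (\<ominus> \<one>) \<otimes> u" by algebra
    then show ?thesis using mult[OF B'(5)[OF B'(3)] that] by simp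
  qed
  have inv: "inv\<^bsub>add_monoid (R\<lparr>carrier := B\<rparr>)\<^esub> u = \<ominus> u" if "u \<in> J" for u
  proof -
    have "u \<in> B" "u \<in> carrier R" using that J B' by auto
    then have "\<ominus>\<^bsub>R\<lparr>carrier := B\<rparr>\<^esub> u = \<ominus> u"
      using B'(5) by (intro B.minus_equality) (auto simp: l_neg)
    then show ?thesis by (simp add: a_inv_def)
  qed
  show ?thesis
  proof (rule idealI)
    show "subgroup J (add_monoid (R\<lparr>carrier := B\<rparr>))"
      using J add neg inv by unfold_locales auto
  next
    fix u b
    assume ub: "u \<in> J" "b \<in> carrier (R\<lparr>carrier := B\<rparr>)"
    then show "b \<otimes>\<^bsub>R\<lparr>carrier := B\<rparr>\<^esub> u \<in> J" using mult by simp
    moreover have "u \<otimes> b = b \<otimes> u" using ub J B'(1) by (intro m_comm) auto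
    ultimately show "u \<otimes>\<^bsub>R\<lparr>carrier := B\<rparr>\<^esub> b \<in> J" by simp
  qed (rule subring_is_ring[OF B])
qed

lemma ideal_of_subringD:
  assumes J: "ideal J (R\<lparr>carrier := B\<rparr>)"
  shows "J \<subseteq> B" "\<zero> \<in> J"
    and "\<And>u v. u \<in> J \<Longrightarrow> v \<in> J \<Longrightarrow> u \<oplus> v \<in> J"
    and "\<And>b u. b \<in> B \<Longrightarrow> u \<in> J \<Longrightarrow> b \<otimes> u \<in> J"
proof -
  interpret J: ideal J "R\<lparr>carrier := B\<rparr>" by (rule J)
  show "J \<subseteq> B" "\<zero> \<in> J" using J.a_subset additive_subgroup.zero_closed[OF ideal.axioms(1)[OF J]] by auto
  show "u \<oplus> v \<in> J" if "u \<in> J" "v \<in> J" for u v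
    using additive_subgroup.a_closed[OF ideal.axioms(1)[OF J] that] by simp
  show "b \<otimes> u \<in> J" if "b \<in> B" "u \<in> J" for b u using J.I_l_closed that by simp
qed

section \<open>Stationary chains of simple extensions and saturated subrings\<close>

lemma simple_extension_mult_stabilises:
  assumes A: "subring A R" and fin: "extension_length R A \<noteq> \<infinity>"
    and a: "a \<in> A" and x: "x \<in> carrier R"
  shows "\<exists>n::nat. simple_extension A (a \<otimes> (a [^] n \<otimes> x)) = simple_extension A (a [^] n \<otimes> x)"
proof -
  note A' = subringE[OF A]
  have ac: "a \<in> carrier R" using a A' by auto
  define y where "y n = a [^] n \<otimes> x" for n :: nat
  have y: "y n \<in> carrier R" for n using ac x by (simp add: y_def)
  have y_Suc: "y (Suc n) = a \<otimes> y n" for n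
    using ac x by (simp add: y_def m_ac)
  \<comment> \<open>Each \<open>y (Suc n)\<close> is a multiple of \<open>y n\<close>, so the rings
    \<open>A[a^n x]\<close> descend and finite length makes two neighbours equal.\<close>
  have "y (Suc n) \<in> simple_extension A (y n)" for n
    unfolding y_Suc
    using subringE(6)[OF simple_extension_subring[OF A y]] simple_extension_mem[OF A y]
      simple_extension_incl[OF A'(1) y] a by blast
  then have "simple_extension A (y (Suc n)) \<subseteq> simple_extension A (y n)" for n
    by (intro simple_extension_subring_incl simple_extension_subring simple_extension_incl A A' y)
  moreover have "simple_extension A (y n) \<in> intermediate_rings R A" for n
    using simple_extension_subring[OF A y] simple_extension_incl[OF A'(1) y]
    by (auto simp: intermediate_rings_def)
  ultimately have "\<exists>n. simple_extension A (y (Suc n)) = simple_extension A (y n)"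
    using finite_length_dcc[OF fin, of "\<lambda>n. simple_extension A (y n)"] by blast
  then show ?thesis unfolding y_Suc by (simp add: y_def)
qed

text \<open>Stationarity at \<open>a^n x\<close> supplies the hypothesis of
  \<open>cyclic_nakayama\<close> for this element, which is integral along with
  \<open>x\<close>.\<close>

lemma integral_element_descent:
  assumes A: "subring A R" and fin: "extension_length R A \<noteq> \<infinity>"
    and a: "a \<in> A" and x: "x \<in> carrier R" and int: "integral_over A x"
  shows "\<exists>n::nat. \<exists>y\<in>A. (\<one> \<ominus> a \<otimes> y) \<otimes> (a [^] n \<otimes> x) \<in> A"
proof -
  note A' = subringE[OF A]
  obtain n :: nat where
    n: "simple_extension A (a \<otimes> (a [^] n \<otimes> x)) = simple_extension A (a [^] n \<otimes> x)"
    using simple_extension_mult_stabilises[OF A fin a x] by blast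
  have an: "a [^] n \<in> A" using a by (induction n) (auto simp: A')
  then have ax: "a [^] n \<otimes> x \<in> carrier R" using A'(1) x by auto
  have "a [^] n \<otimes> x \<in> simple_extension A (a \<otimes> (a [^] n \<otimes> x))"
    unfolding n by (rule simple_extension_mem[OF A ax])
  from simple_extension_mult_subset[OF A a ax this]
  show ?thesis
    using cyclic_nakayama[OF A ax a integral_over_mult[OF A x an int]] by blast
qed

text \<open>
  The initial segments of the Horner scheme of a relation \<open>p(s) = 0\<close> have values \<open>b\<close> such that
  \<open>b \<otimes> s\<close> is integral over \<open>A\<close>, so they lie in the denominator ideal of \<open>s\<close>.
\<close>

lemma coefficients_in_denominator_ideal:
  assumes A: "subring A R" and B: "subring B R" "A \<subseteq> B"
    and closed: "\<And>x. x \<in> B \<Longrightarrow> integral_over A x \<Longrightarrow> x \<in> A"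
    and s: "s \<in> B" and J: "ideal J (R\<lparr>carrier := B\<rparr>)" "denominators R A {s} \<subseteq> J"
    and p: "set p \<subseteq> A" "eval p s = \<zero>"
  shows "set p \<subseteq> J"
proof -
  \<comment> \<open>The leading coefficient stays arbitrary in the induction, since a Horner step
    replaces the next coefficient \<open>r\<close> by \<open>b s + r\<close>.\<close>
  have "set (b # p) \<subseteq> J" if "set (b # p) \<subseteq> A" "eval (b # p) s = \<zero>" for b p
    using that
  proof (induction p arbitrary: b)
    case Nil
    then have "b = \<zero>" using subringE(1)[OF A] by auto
    then show ?case using ideal_of_subringD(2)[OF J(1)] by simp
  next
    case (Cons r p)
    note A' = subringE[OF A]
    note J' = ideal_of_subringD[OF J(1)]
    have p: "b \<in> A" "r \<in> A" "set p \<subseteq> A" using Cons.prems by auto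
    have sc: "s \<in> carrier R" using s subringE(1)[OF B(1)] by auto
    have c: "b \<in> carrier R" "r \<in> carrier R" "eval p s \<in> carrier R" "s \<in> carrier R"
      "s [^] length p \<in> carrier R"
      using p A'(1) sc eval_in_carrier[of p s] by auto
    have rel: "b \<otimes> (s [^] length p \<otimes> s) \<oplus> (r \<otimes> s [^] length p \<oplus> eval p s) = \<zero>"
      using Cons.prems(2) by simp
    have "r \<otimes> s [^] length p \<oplus> eval p s \<in> poly_values A s (Suc (length p))"
      using p by (intro poly_values_SucI[OF refl]) (auto simp: poly_values_def)
    then have "\<ominus> \<one> \<otimes> (r \<otimes> s [^] length p \<oplus> eval p s) \<in> poly_values A s (Suc (length p))"
      by (intro poly_values_smult[OF A c(4)] A')
    moreover have "b \<otimes> s [^] Suc (length p) = \<ominus> \<one> \<otimes> (r \<otimes> s [^] length p \<oplus> eval p s)"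
    proof -
      have "b \<otimes> s [^] Suc (length p) = b \<otimes> (s [^] length p \<otimes> s) \<oplus>
        (r \<otimes> s [^] length p \<oplus> eval p s) \<oplus> \<ominus> \<one> \<otimes> (r \<otimes> s [^] length p \<oplus> eval p s)"
        unfolding nat_pow_Suc using c by algebra
      then show ?thesis unfolding rel using c by simp
    qed
    ultimately have "b \<otimes> s [^] Suc (length p) \<in> poly_values A s (Suc (length p))" by metis
    then have "integral_over A (b \<otimes> s)" by (rule leading_coeff_mult_integral[OF A c(4) p(1)])
    moreover have "b \<otimes> s \<in> B" using p B(2) s subringE(6)[OF B(1)] by auto
    \<comment> \<open>\<open>b s\<close> is integral over \<open>A\<close> and lies in
      \<open>B\<close>, hence in \<open>A\<close>; this makes \<open>b\<close> a denominator of
      \<open>s\<close>.\<close>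
    ultimately have bs: "b \<otimes> s \<in> A" using closed by blast
    then have bJ: "b \<in> J" using J(2) p by (auto simp: denominators_def)
    \<comment> \<open>Being in \<open>A\<close>, \<open>b s\<close> can be absorbed into the next
      coefficient, which shortens the relation by one.\<close>
    have "(b \<otimes> s \<oplus> r) \<otimes> s [^] length p \<oplus> eval p s = \<zero>"
      unfolding rel[symmetric] using c by algebra
    then have "set ((b \<otimes> s \<oplus> r) # p) \<subseteq> J"
      using p bs A'(7) by (intro Cons.IH) auto
    then have "b \<otimes> s \<oplus> r \<in> J" "set p \<subseteq> J" by auto
    \<comment> \<open>\<open>r\<close> is recovered from \<open>b s + r\<close>: since
      \<open>J\<close> is an ideal of \<open>B\<close>, it contains \<open>s b\<close> even if
      \<open>s\<close> is not in \<open>A\<close>.\<close>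
    moreover have "r = (b \<otimes> s \<oplus> r) \<oplus> (\<ominus> s) \<otimes> b" using c by algebra
    moreover have "(\<ominus> s) \<otimes> b \<in> J" using J'(4) bJ s subringE(5)[OF B(1)] by simp
    ultimately have "r \<in> J" using J'(3) by metis
    then show ?case using bJ \<open>set p \<subseteq> J\<close> by simp
  qed
  then show ?thesis using p by (cases p) auto
qed

lemma simple_extension_eval:
  assumes A: "A \<subseteq> carrier R" and x: "x \<in> carrier R" and w: "w \<in> simple_extension A x"
  shows "\<exists>p. set p \<subseteq> A \<and> w = eval p x"
  using w
proof induction
  case zero
  then show ?case by (intro exI[of _ "[]"]) simp
next
  case (lin w k)
  then obtain p where p: "set p \<subseteq> A" "w = eval p x" by blast
  then have "eval (p @ [k]) x = w \<otimes> x \<oplus> k"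
    using eval_append_aux[of p k x] A x lin by auto
  then show ?case using p lin by (intro exI[of _ "p @ [k]"]) auto
qed

text \<open>From \<open>y\<close> in \<open>A[y^2]\<close> comes a relation
  \<open>z y^2 - y + k = 0\<close> with \<open>z\<close> in \<open>A[y]\<close>. Its coefficient -1
  lies in \<open>J\<close> together with all others.\<close>

lemma denominator_ideal_unit_of_square:
  assumes A: "subring A R" and B: "subring B R" "A \<subseteq> B"
    and closed: "\<And>x. x \<in> B \<Longrightarrow> integral_over A x \<Longrightarrow> x \<in> A"
    and y: "y \<in> B" and sq: "y \<in> simple_extension A (y \<otimes> y)"
    and J: "ideal J (R\<lparr>carrier := B\<rparr>)" "denominators R A {y} \<subseteq> J"
  shows "\<one> \<in> J"
proof -
  note A' = subringE[OF A]
  note J' = ideal_of_subringD[OF J(1)]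
  have yc: "y \<in> carrier R" using y subringE(1)[OF B(1)] by auto
  have "\<exists>z k. y = z \<otimes> (y \<otimes> y) \<oplus> k \<and> z \<in> simple_extension A (y \<otimes> y) \<and> k \<in> A"
    using sq
  proof cases
    case zero
    show ?thesis
      by (rule exI[of _ \<zero>], rule exI[of _ \<zero>]) (use yc zero A'(2) in simp)
  qed blast
  then obtain z k where zk: "y = z \<otimes> (y \<otimes> y) \<oplus> k" "z \<in> simple_extension A (y \<otimes> y)" "k \<in> A"
    by blast
  have "simple_extension A (y \<otimes> y) \<subseteq> simple_extension A y"
    using subringE(6)[OF simple_extension_subring[OF A yc]] simple_extension_mem[OF A yc]
    by (intro simple_extension_subring_incl simple_extension_subring simple_extension_incl A A' yc)
      auto
  then obtain p where p: "set p \<subseteq> A" "z = eval p y"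
    using simple_extension_eval[OF A'(1) yc] zk(2) by blast
  have c: "z \<in> carrier R" "k \<in> carrier R"
    using p eval_in_carrier[of p y] A'(1) yc zk(3) by auto
  \<comment> \<open>The entries of \<open>p\<close> sit in degrees 2 and above, so they do not
    interfere with the coefficient -1 of \<open>y\<close>.\<close>
  have "eval (p @ [\<ominus> \<one>, k]) y = z \<otimes> y [^] (2::nat) \<oplus> eval [\<ominus> \<one>, k] y"
    using eval_append[of p "[\<ominus> \<one>, k]" y] p A'(1) c yc by (auto simp: numeral_2_eq_2)
  also have "\<dots> = (z \<otimes> (y \<otimes> y) \<oplus> k) \<oplus> \<ominus> y"
    using c yc by (simp add: numeral_2_eq_2) algebra
  also have "\<dots> = \<zero>" using zk(1) yc by (metis r_neg)
  finally have "set (p @ [\<ominus> \<one>, k]) \<subseteq> J"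
    using p zk(3) A'
    by (intro coefficients_in_denominator_ideal[OF A B closed y J]) auto
  then have "\<ominus> \<one> \<otimes> \<ominus> \<one> \<in> J"
    using A'(5)[OF A'(3)] B(2) by (intro J') auto
  moreover have "\<ominus> \<one> \<otimes> \<ominus> \<one> = \<one>" by algebra
  ultimately show ?thesis by simp
qed

text \<open>For the ideal \<open>J\<close> of \<open>B\<close> generated by \<open>(A : t)\<close>
  this says \<open>(A : t)B = B\<close>. The stationary chain \<open>A[t^(2^n)]\<close> reduces it
  to the preceding lemma.\<close>

lemma denominator_ideal_unit:
  assumes A: "subring A R" and fin: "extension_length R A \<noteq> \<infinity>" and B: "subring B R" "A \<subseteq> B"
    and closed: "\<And>x. x \<in> B \<Longrightarrow> integral_over A x \<Longrightarrow> x \<in> A"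
    and t: "t \<in> B" and J: "ideal J (R\<lparr>carrier := B\<rparr>)" "denominators R A {t} \<subseteq> J"
  shows "\<one> \<in> J"
proof -
  note A' = subringE[OF A]
  note B' = subringE[OF B(1)]
  define y where "y n = t [^] ((2::nat) ^ n)" for n
  have "t [^] k \<in> B" for k :: nat
    using t by (induction k) (auto simp: B')
  then have yB: "y n \<in> B" for n unfolding y_def .
  then have y: "y n \<in> carrier R" for n using B' by auto
  have y_Suc: "y (Suc n) = y n \<otimes> y n" for n
    using t subsetD[OF B'(1)] by (simp add: y_def nat_pow_mult mult_2)
  have "y (Suc n) \<in> simple_extension A (y n)" for n
    unfolding y_Suc
    using subringE(6)[OF simple_extension_subring[OF A y]] simple_extension_mem[OF A y] by blast
  then have "simple_extension A (y (Suc n)) \<subseteq> simple_extension A (y n)" for n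
    by (intro simple_extension_subring_incl simple_extension_subring simple_extension_incl A A' y)
  moreover have "simple_extension A (y n) \<in> intermediate_rings R A" for n
    using simple_extension_subring[OF A y] simple_extension_incl[OF A'(1) y]
    by (auto simp: intermediate_rings_def)
  ultimately obtain n where n: "simple_extension A (y (Suc n)) = simple_extension A (y n)"
    using finite_length_dcc[OF fin, of "\<lambda>n. simple_extension A (y n)"] by blast
  \<comment> \<open>Passing to the power \<open>y m\<close> does not enlarge the denominator ideal:
    if \<open>b y^2\<close> is in \<open>A\<close>, then \<open>b y\<close> is a root of
    \<open>X^2 = b (b y^2)\<close>, hence integral and in \<open>A\<close>.\<close>
  have "denominators R A {y m} \<subseteq> denominators R A {t}" for m
  proof (induction m)
    case 0
    then show ?case using t B' by (auto simp: y_def)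
  next
    case (Suc m)
    have "b \<in> denominators R A {y m}" if "b \<in> denominators R A {y (Suc m)}" for b
    proof -
      have b: "b \<in> A" "b \<otimes> (y m \<otimes> y m) \<in> A"
        using that by (auto simp: denominators_def y_Suc)
      have bc: "b \<in> carrier R" using b A' by auto
      have by_c: "b \<otimes> y m \<in> carrier R" using bc y by simp
      have "(b \<otimes> y m) [^] Suc (Suc 0) = b \<otimes> (b \<otimes> (y m \<otimes> y m))"
        using bc y by (simp add: m_ac)
      moreover have "b \<otimes> (b \<otimes> (y m \<otimes> y m)) \<in> poly_values A (b \<otimes> y m) (Suc (Suc 0))"
        using b A' by (intro poly_values_const[OF A by_c]) auto
      ultimately have "integral_over A (b \<otimes> y m)" unfolding integral_over_def by metis
      then have "b \<otimes> y m \<in> A" using closed[of "b \<otimes> y m"] b B yB B' by blast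
      then show ?thesis using b by (simp add: denominators_def)
    qed
    then show ?case using Suc by blast
  qed
  then have "denominators R A {y n} \<subseteq> J" using J(2) by blast
  moreover have "y n \<in> simple_extension A (y n \<otimes> y n)"
    using n simple_extension_mem[OF A y] by (simp add: y_Suc)
  ultimately show ?thesis
    using denominator_ideal_unit_of_square[OF A B closed yB _ J(1)] by blast
qed

lemma saturated_subring_eq:
  assumes A: "subring A R" and fin: "extension_length R A \<noteq> \<infinity>" and B: "subring B R" "A \<subseteq> B"
    and a: "a \<in> A" and sat: "\<And>z. z \<in> B \<Longrightarrow> a \<otimes> z \<in> A \<Longrightarrow> z \<in> A"
    and sat1: "\<And>y z. y \<in> A \<Longrightarrow> z \<in> B \<Longrightarrow> (\<one> \<ominus> a \<otimes> y) \<otimes> z \<in> A \<Longrightarrow> z \<in> A"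
  shows "B = A"
proof -
  note A' = subringE[OF A]
  note B' = subringE[OF B(1)]
  have ac: "a \<in> carrier R" using a A' by auto
  have an: "a [^] n \<in> A" for n :: nat using a by (induction n) (auto simp: A')
  have anB: "a [^] n \<otimes> z \<in> B" if "z \<in> B" for n :: nat and z
    using an that B B'(6) by blast
  have satn: "z \<in> A" if "z \<in> B" "a [^] n \<otimes> z \<in> A" for n :: nat and z
    using that
  proof (induction n)
    case 0
    then show ?case using B' by auto
  next
    case (Suc n)
    have "z \<in> carrier R" using Suc B' by auto
    then have "a \<otimes> (a [^] n \<otimes> z) \<in> A" using Suc ac by (simp add: m_ac)
    then have "a [^] n \<otimes> z \<in> A" using sat anB Suc by blast
    then show ?case using Suc by blast
  qed
  \<comment> \<open>Some \<open>(1 - a y) a^n\<close> multiplies an integral \<open>x\<close> into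
    \<open>A\<close>, and saturation cancels both kinds of factors.\<close>
  have closed: "x \<in> A" if x: "x \<in> B" "integral_over A x" for x
  proof -
    have "x \<in> carrier R" using x B' by auto
    from integral_element_descent[OF A fin a this x(2)]
    show ?thesis using sat1 satn anB[OF x(1)] x(1) by blast
  qed
  have "s \<in> A" if s: "s \<in> B" for s
  proof -
    have sc: "s \<in> carrier R" using s B' by auto
    obtain n :: nat where
      n: "simple_extension A (a \<otimes> (a [^] n \<otimes> s)) = simple_extension A (a [^] n \<otimes> s)"
      using simple_extension_mult_stabilises[OF A fin a sc] by blast
    define s' where "s' = a [^] n \<otimes> s"
    define E where "E = simple_extension A s'"
    have s': "s' \<in> B" "s' \<in> carrier R" using anB[OF s] B' by (auto simp: s'_def)
    have E: "subring E R" "A \<subseteq> E" "E \<subseteq> B" "s' \<in> E"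
      unfolding E_def
      using simple_extension_subring[OF A s'(2)] simple_extension_incl[OF A'(1) s'(2)]
        simple_extension_subring_incl[OF B s'(1)] simple_extension_mem[OF A s'(2)] by auto
    note E' = subringE[OF E(1)]
    note carr = subsetD[OF A'(1)] subsetD[OF E'(1)]
    \<comment> \<open>By the choice of \<open>n\<close>, the ring \<open>E = A[s']\<close> equals
      \<open>A + aE\<close>.\<close>
    have decomp: "\<exists>r\<in>A. \<exists>w\<in>E. z = r \<oplus> a \<otimes> w" if "z \<in> E" for z
      using simple_extension_mult_subset[OF A a s'(2), of z] that n by (simp add: E_def s'_def)
    define D where "D = denominators R A {s'}"
    have DA: "D \<subseteq> A" by (auto simp: D_def denominators_def)
    \<comment> \<open>\<open>D\<close> is an ideal of \<open>A\<close> only; adding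
      \<open>aE\<close> makes it stable under \<open>E = A + aE\<close>.\<close>
    define J where "J = {d \<oplus> a \<otimes> w | d w. d \<in> D \<and> w \<in> E}"
    have D0: "\<zero> \<in> D" using A' s' by (simp add: D_def denominators_def)
    have Dadd: "d \<oplus> e \<in> D" if "d \<in> D" "e \<in> D" for d e
      using that A' s' carr by (auto simp: D_def denominators_def l_distr)
    have Dmult: "r \<otimes> d \<in> D" if "d \<in> D" "r \<in> A" for d r
      using that A' s' carr by (auto simp: D_def denominators_def m_assoc)
    have "ideal J (R\<lparr>carrier := E\<rparr>)"
    proof (rule ideal_of_subringI[OF E(1)])
      have "d \<oplus> a \<otimes> w \<in> E" if "d \<in> D" "w \<in> E" for d w
        using that DA E(2) a by (intro E'(7) E'(6)) auto
      then show "J \<subseteq> E" by (auto simp: J_def)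
      have "\<zero> = \<zero> \<oplus> a \<otimes> \<zero>" using ac by simp
      then show "\<zero> \<in> J" using D0 E'(2) unfolding J_def by blast
    next
      fix u v assume "u \<in> J" "v \<in> J"
      then obtain d w e z where *: "u = d \<oplus> a \<otimes> w" "v = e \<oplus> a \<otimes> z" "d \<in> D" "w \<in> E" "e \<in> D" "z \<in> E"
        by (auto simp: J_def)
      then have "d \<in> carrier R" "e \<in> carrier R" using DA carr by auto
      then have "u \<oplus> v = (d \<oplus> e) \<oplus> a \<otimes> (w \<oplus> z)"
        using * ac carr by algebra
      then show "u \<oplus> v \<in> J" unfolding J_def using Dadd E'(7) * by blast
    next
      fix b u assume b: "b \<in> E" and u: "u \<in> J"
      obtain d w where *: "u = d \<oplus> a \<otimes> w" "d \<in> D" "w \<in> E"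
        using u by (auto simp: J_def)
      obtain r z where rz: "r \<in> A" "z \<in> E" "b = r \<oplus> a \<otimes> z" using decomp[OF b] by blast
      have dE: "d \<in> E" using * DA E(2) by auto
      have "b \<otimes> u = r \<otimes> d \<oplus> a \<otimes> (z \<otimes> d \<oplus> b \<otimes> w)"
        unfolding *(1) rz(3) using * rz(1,2) dE ac carr by algebra
      moreover have "z \<otimes> d \<oplus> b \<otimes> w \<in> E" using E' dE b rz * by simp
      ultimately show "b \<otimes> u \<in> J" unfolding J_def using Dmult rz * by blast
    qed
    moreover have "denominators R A {s'} \<subseteq> J"
    proof
      fix d assume d: "d \<in> denominators R A {s'}"
      then have "d = d \<oplus> a \<otimes> \<zero>" using ac DA carr(1)[of d] by (auto simp: D_def)
      then show "d \<in> J" using d E'(2) unfolding J_def D_def by blast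
    qed
    ultimately have "\<one> \<in> J"
      using denominator_ideal_unit[OF A fin E(1,2) closed E(4)] E(3) by blast
    \<comment> \<open>From \<open>1 = d + a w\<close>, saturation first puts \<open>w\<close> into
      \<open>A\<close> because \<open>a w = 1 - d\<close>. Then \<open>d = 1 - a w\<close>
      multiplies \<open>s'\<close> into \<open>A\<close> and can be cancelled.\<close>
    then obtain d w where dw: "\<one> = d \<oplus> a \<otimes> w" "d \<in> D" "w \<in> E" by (auto simp: J_def)
    have dA: "d \<in> A" using dw DA by auto
    have "a \<otimes> w = (d \<oplus> a \<otimes> w) \<ominus> d" using dA dw(3) carr ac by algebra
    then have "a \<otimes> w = \<one> \<ominus> d" using dw(1) by simp
    then have "a \<otimes> w \<in> A" using dA A' by (simp add: a_minus_def)
    then have wA: "w \<in> A" using sat dw(3) E(3) by blast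
    have "(d \<oplus> a \<otimes> w) \<ominus> a \<otimes> w = d" using dA dw(3) carr ac by algebra
    then have "\<one> \<ominus> a \<otimes> w = d" using dw(1) by simp
    then have "(\<one> \<ominus> a \<otimes> w) \<otimes> s' \<in> A" using dw(2) by (simp add: D_def denominators_def)
    then have "s' \<in> A" using sat1 wA s'(1) by blast
    then show ?thesis using satn s by (simp add: s'_def)
  qed
  then show ?thesis using B by blast
qed

end

section \<open>Flat epimorphisms\<close>

text \<open>
  The denominator ideals \<open>(A : t)\<close> generate the unit ideal of \<open>T\<close>: this is Lazard's
  characterisation of the flat epimorphisms \<open>A \<subseteq> T\<close>.
\<close>

locale denominator_extension = cring R for R (structure) +
  fixes A T :: "'a set"
  assumes A: "subring A R" and T: "subring T R" and A_T: "A \<subseteq> T"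
    and unit: "\<lbrakk>t \<in> T; ideal J (R\<lparr>carrier := T\<rparr>); denominators R A {t} \<subseteq> J\<rbrakk> \<Longrightarrow> \<one> \<in> J"
begin

abbreviation "N \<equiv> ring_as_module (R\<lparr>carrier := T\<rparr>)"
abbreviation "RA \<equiv> R\<lparr>carrier := A\<rparr>"

lemma N_simps [simp]:
  "carrier N = T" "ring.add N = (\<oplus>)" "ring.zero N = \<zero>" "module.smult N = (\<otimes>)"
  by (simp_all add: ring_as_module_def)

lemmas A_closed = subringE[OF A]
lemmas T_closed = subringE[OF T]
lemmas A_carr = subsetD[OF A_closed(1)]
lemmas T_carr = subsetD[OF T_closed(1)]

lemma RA_cring: "cring RA"
  using subcring_iff[OF A_closed(1)] subcringI'[OF A] by simp

lemma module_N: "module RA N"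
proof (rule moduleI[OF RA_cring])
  interpret T: ring "R\<lparr>carrier := T\<rparr>" by (rule subring_is_ring[OF T])
  show "abelian_group N"
  proof (rule abelian_groupI)
    fix x assume "x \<in> carrier N"
    then have "x \<in> T" by simp
    then show "\<exists>y\<in>carrier N. y \<oplus>\<^bsub>N\<^esub> x = \<zero>\<^bsub>N\<^esub>"
      using T_closed(5) T_carr l_neg by (intro bexI[of _ "\<ominus> x"]) auto
  qed (use T_closed T_carr in \<open>auto simp: a_ac\<close>)
qed (use T_closed A_T T_carr A_carr in \<open>auto simp: l_distr r_distr m_assoc\<close>)

text \<open>Induction on \<open>E\<close>: the \<open>x\<close> in \<open>T\<close> with
  \<open>x (A : E)\<close> inside \<open>J\<close> form an ideal containing \<open>(A : t)\<close>,
  because a denominator of \<open>t\<close> times one of \<open>E\<close> is a denominator of both.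
  So it contains 1, and \<open>(A : E)\<close> itself lies in \<open>J\<close>.\<close>

lemma finite_denominators_unit:
  assumes "finite E" "E \<subseteq> T" "ideal J (R\<lparr>carrier := T\<rparr>)" "denominators R A E \<subseteq> J"
  shows "\<one> \<in> J"
  using assms
proof (induction E arbitrary: J rule: finite_induct)
  case empty
  then show ?case using A_closed(3) by (auto simp: denominators_def)
next
  case (insert t E)
  note J = ideal_of_subringD[OF insert.prems(2)]
  define Q where "Q = {x \<in> T. \<forall>b\<in>denominators R A E. x \<otimes> b \<in> J}"
  have den: "b \<in> T" "b \<in> carrier R" if "b \<in> denominators R A E" for b
    using that A_T T_carr by (auto simp: denominators_def)
  have "ideal Q (R\<lparr>carrier := T\<rparr>)"
  proof (rule ideal_of_subringI[OF T])
    show "Q \<subseteq> T" "\<zero> \<in> Q" using den J(2) T_closed(2) by (auto simp: Q_def)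
  next
    fix u v assume "u \<in> Q" "v \<in> Q"
    then show "u \<oplus> v \<in> Q" using J(3) T_closed(7) T_carr den by (auto simp: Q_def l_distr)
  next
    fix b u assume "b \<in> T" "u \<in> Q"
    then show "b \<otimes> u \<in> Q" using J(4) T_closed(6) T_carr den by (auto simp: Q_def m_assoc)
  qed
  moreover have "denominators R A {t} \<subseteq> Q"
  proof
    fix b assume b: "b \<in> denominators R A {t}"
    then have bA: "b \<in> A" "b \<otimes> t \<in> A" by (auto simp: denominators_def)
    have "b \<otimes> d \<in> denominators R A (insert t E)" if d: "d \<in> denominators R A E" for d
    proof -
      have dA: "d \<in> A" "\<And>e. e \<in> E \<Longrightarrow> d \<otimes> e \<in> A" using d by (auto simp: denominators_def)
      have "b \<otimes> d \<otimes> e \<in> A" if "e \<in> E" for e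
      proof -
        have "b \<otimes> d \<otimes> e = b \<otimes> (d \<otimes> e)"
          using bA dA that insert.prems(1) A_carr T_carr by (intro m_assoc) auto
        then show ?thesis using bA dA that A_closed(6) by simp
      qed
      moreover have "b \<otimes> d \<otimes> t = d \<otimes> (b \<otimes> t)"
        using bA dA insert.prems(1) A_carr T_carr by (simp add: m_ac)
      then have "b \<otimes> d \<otimes> t \<in> A" using bA dA A_closed(6) by simp
      ultimately show ?thesis using bA dA A_closed(6) by (auto simp: denominators_def)
    qed
    then show "b \<in> Q" using bA A_T insert.prems(3) by (auto simp: Q_def)
  qed
  ultimately have "\<one> \<in> Q" using unit insert.prems(1) by blast
  then have "denominators R A E \<subseteq> J" using den by (auto simp: Q_def)
  then show ?case using insert by blast
qed

text \<open>The \<open>r\<close> with \<open>f(r) f(y) = f(r) g(y)\<close> form an ideal. It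
  contains every \<open>b\<close> with \<open>b y\<close> in \<open>A\<close>, as \<open>f\<close>
  and \<open>g\<close> agree on \<open>b\<close> and \<open>b y\<close>; hence it contains
  1.\<close>

lemma epimorphism: "cring_epimorphism TYPE('u) RA (R\<lparr>carrier := T\<rparr>) (\<lambda>x. x)"
  unfolding cring_epimorphism_def
proof (intro conjI allI impI ballI)
  show "(\<lambda>x. x) \<in> ring_hom RA (R\<lparr>carrier := T\<rparr>)"
    using A_T by (auto simp: ring_hom_def)
next
  fix C :: "'u ring" and f g y
  assume *: "cring C \<and> f \<in> ring_hom (R\<lparr>carrier := T\<rparr>) C \<and> g \<in> ring_hom (R\<lparr>carrier := T\<rparr>) C \<and>
    (\<forall>x\<in>carrier RA. f x = g x)" and y: "y \<in> carrier (R\<lparr>carrier := T\<rparr>)"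
  interpret C: cring C using * by simp
  have f: "\<And>x. x \<in> T \<Longrightarrow> f x \<in> carrier C" "\<And>x y. x \<in> T \<Longrightarrow> y \<in> T \<Longrightarrow> f (x \<otimes> y) = f x \<otimes>\<^bsub>C\<^esub> f y"
    "\<And>x y. x \<in> T \<Longrightarrow> y \<in> T \<Longrightarrow> f (x \<oplus> y) = f x \<oplus>\<^bsub>C\<^esub> f y" "f \<one> = \<one>\<^bsub>C\<^esub>"
    and g: "\<And>x. x \<in> T \<Longrightarrow> g x \<in> carrier C" "\<And>x y. x \<in> T \<Longrightarrow> y \<in> T \<Longrightarrow> g (x \<otimes> y) = g x \<otimes>\<^bsub>C\<^esub> g y"
    and fg: "\<And>x. x \<in> A \<Longrightarrow> f x = g x"
    using * by (auto simp: ring_hom_def)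
  have yT: "y \<in> T" using y by simp
  define Q where "Q = {r \<in> T. f r \<otimes>\<^bsub>C\<^esub> f y = f r \<otimes>\<^bsub>C\<^esub> g y}"
  have "f \<zero> \<oplus>\<^bsub>C\<^esub> f \<zero> = f \<zero>" using f(3)[of \<zero> \<zero>] T_closed(2) by simp
  then have f0: "f \<zero> = \<zero>\<^bsub>C\<^esub>" using C.add.r_cancel_one' f(1) T_closed(2) by metis
  have "ideal Q (R\<lparr>carrier := T\<rparr>)"
  proof (rule ideal_of_subringI[OF T])
    show "Q \<subseteq> T" "\<zero> \<in> Q" using f0 f g yT T_closed(2) by (auto simp: Q_def)
  next
    fix u v assume "u \<in> Q" "v \<in> Q"
    then show "u \<oplus> v \<in> Q" using f g yT T_closed(7) by (auto simp: Q_def C.l_distr)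
  next
    fix b u assume "b \<in> T" "u \<in> Q"
    then show "b \<otimes> u \<in> Q" using f g yT T_closed(6) by (auto simp: Q_def C.m_assoc)
  qed
  moreover have "denominators R A {y} \<subseteq> Q"
  proof
    fix b assume "b \<in> denominators R A {y}"
    then have b: "b \<in> A" "b \<otimes> y \<in> A" "b \<in> T" using A_T by (auto simp: denominators_def)
    then show "b \<in> Q" using f(2) g(2) fg yT by (auto simp: Q_def) metis
  qed
  ultimately have "\<one> \<in> Q" using unit yT by blast
  then show "f y = g y" using f g yT by (auto simp: Q_def)
qed

text \<open>
  \<open>scaled M b\<close> sends \<open>\<Sum> x \<otimes> t\<close> to \<open>\<Sum> (b t) x\<close> whenever \<open>b\<close> is a common denominator of the \<open>t\<close>;
  an element of \<open>M \<otimes> T\<close> vanishes iff its images under these partial maps do.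
\<close>

definition scaled :: "('a, 'u) module \<Rightarrow> 'a \<Rightarrow> ('u \<times> 'a \<Rightarrow>\<^sub>0 int) \<Rightarrow> 'u" where
  "scaled M b = (SOME h. h \<in> hom (free_Abelian_group (carrier M \<times> T)) (add_monoid M) \<and>
     (\<forall>x\<in>carrier M. \<forall>t\<in>T. h (frag_of (x, t)) = (if b \<otimes> t \<in> A then (b \<otimes> t) \<odot>\<^bsub>M\<^esub> x else \<zero>\<^bsub>M\<^esub>)))"

text \<open>The map \<open>id \<otimes> r\<close> lifted to formal sums, where additivity in
  \<open>r\<close> holds only modulo the tensor kernel.\<close>

definition shift :: "'a \<Rightarrow> ('u \<times> 'a \<Rightarrow>\<^sub>0 int) \<Rightarrow> ('u \<times> 'a \<Rightarrow>\<^sub>0 int)" where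
  "shift r = frag_extend (\<lambda>(x, t). frag_of (x, r \<otimes> t))"

section \<open>Detecting the tensor kernel of \<open>M \<otimes> T\<close> by denominators\<close>

context
  fixes M :: "('a, 'u) module"
  assumes M: "module RA M"
begin

interpretation M: module RA M by (rule M)

abbreviation "F \<equiv> free_Abelian_group (carrier M \<times> T)"
abbreviation "K \<equiv> tensor_kernel RA M N"

text \<open>The universal property of the free abelian group supplies the map chosen in
  \<open>scaled\<close>. The value zero for \<open>b t\<close> outside \<open>A\<close> is a dummy
  that makes the prescription total.\<close>

lemma scaled_hom: "scaled M b \<in> hom F (add_monoid M)"
  and scaled_frag_of: "\<lbrakk>x \<in> carrier M; t \<in> T\<rbrakk> \<Longrightarrow>
    scaled M b (frag_of (x, t)) = (if b \<otimes> t \<in> A then (b \<otimes> t) \<odot>\<^bsub>M\<^esub> x else \<zero>\<^bsub>M\<^esub>)"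
proof -
  let ?f = "\<lambda>(x, t). if b \<otimes> t \<in> A then (b \<otimes> t) \<odot>\<^bsub>M\<^esub> x else \<zero>\<^bsub>M\<^esub>"
  have "?f ` (carrier M \<times> T) \<subseteq> carrier (add_monoid M)" by auto
  from M.a_comm_group[THEN comm_group.free_Abelian_group_universal, OF this]
  obtain h where "h \<in> hom F (add_monoid M)" "\<And>x. x \<in> carrier M \<times> T \<Longrightarrow> h (frag_of x) = ?f x"
    by blast
  then have "\<exists>h. h \<in> hom F (add_monoid M) \<and> (\<forall>x\<in>carrier M. \<forall>t\<in>T.
      h (frag_of (x, t)) = (if b \<otimes> t \<in> A then (b \<otimes> t) \<odot>\<^bsub>M\<^esub> x else \<zero>\<^bsub>M\<^esub>))"
    by (intro exI[of _ h]) auto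
  from someI_ex[OF this, folded scaled_def]
  show "scaled M b \<in> hom F (add_monoid M)"
    "\<lbrakk>x \<in> carrier M; t \<in> T\<rbrakk> \<Longrightarrow>
      scaled M b (frag_of (x, t)) = (if b \<otimes> t \<in> A then (b \<otimes> t) \<odot>\<^bsub>M\<^esub> x else \<zero>\<^bsub>M\<^esub>)"
    by auto
qed

lemma scaled_group_hom: "group_hom F (add_monoid M) (scaled M b)"
  using scaled_hom M.add.is_group by (intro group_hom.intro) (auto simp: group_hom_axioms_def)

lemma scaled_closed: "Poly_Mapping.keys c \<subseteq> carrier M \<times> T \<Longrightarrow> scaled M b c \<in> carrier M"
  using group_hom.hom_closed[OF scaled_group_hom, of c b] by simp

lemma scaled_zero: "scaled M b 0 = \<zero>\<^bsub>M\<^esub>"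
  using group_hom.hom_one[OF scaled_group_hom, of b] by simp

lemma scaled_add:
  "\<lbrakk>Poly_Mapping.keys c \<subseteq> carrier M \<times> T; Poly_Mapping.keys d \<subseteq> carrier M \<times> T\<rbrakk> \<Longrightarrow>
    scaled M b (c + d) = scaled M b c \<oplus>\<^bsub>M\<^esub> scaled M b d"
  using group_hom.hom_mult[OF scaled_group_hom, of c d b] by simp

lemma scaled_uminus:
  "Poly_Mapping.keys c \<subseteq> carrier M \<times> T \<Longrightarrow> scaled M b (- c) = \<ominus>\<^bsub>M\<^esub> scaled M b c"
  using group_hom.hom_inv[OF scaled_group_hom, of c b] by (simp add: a_inv_def)

lemma scaled_diff:
  "\<lbrakk>Poly_Mapping.keys c \<subseteq> carrier M \<times> T; Poly_Mapping.keys d \<subseteq> carrier M \<times> T\<rbrakk> \<Longrightarrow>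
    scaled M b (c - d) = scaled M b c \<ominus>\<^bsub>M\<^esub> scaled M b d"
  using scaled_add[of c "- d" b] scaled_uminus[of d b] by (simp add: a_minus_def)

lemma keys_diff_subset:
  assumes "Poly_Mapping.keys c \<subseteq> B" "Poly_Mapping.keys d \<subseteq> B"
  shows "Poly_Mapping.keys (c - d) \<subseteq> B"
  using keys_diff[of c d] assms by blast

lemma relator_cases [consumes 1, case_names add_left add_right scalar]:
  assumes "c \<in> tensor_relators RA M N"
  obtains x x' y where "c = frag_of (x \<oplus>\<^bsub>M\<^esub> x', y) - frag_of (x, y) - frag_of (x', y)"
      "x \<in> carrier M" "x' \<in> carrier M" "y \<in> T"
    | x y y' where "c = frag_of (x, y \<oplus> y') - frag_of (x, y) - frag_of (x, y')"
        "x \<in> carrier M" "y \<in> T" "y' \<in> T"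
    | a x y where "c = frag_of (a \<odot>\<^bsub>M\<^esub> x, y) - frag_of (x, a \<otimes> y)"
        "a \<in> A" "x \<in> carrier M" "y \<in> T"
  using assms unfolding tensor_relators_def by fastforce

lemma relator_keys:
  assumes "c \<in> tensor_relators RA M N"
  shows "Poly_Mapping.keys c \<subseteq> carrier M \<times> T"
  using assms
proof (cases rule: relator_cases)
  case (add_left x x' y)
  then show ?thesis unfolding add_left(1) by (intro keys_diff_subset) auto
next
  case (add_right x y y')
  then show ?thesis
    unfolding add_right(1) using T_closed(7) by (intro keys_diff_subset) auto
next
  case (scalar a x y)
  then have "a \<otimes> y \<in> T" using A_T T_closed(6) by blast
  then show ?thesis
    unfolding scalar(1) using scalar M.smult_closed by (intro keys_diff_subset) auto
qed

lemma K_subgroup: "subgroup K F"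
  unfolding tensor_kernel_def N_simps
  by (rule group.generate_is_subgroup[OF group_free_Abelian_group])
    (simp add: subset_iff[of "tensor_relators _ _ _"] relator_keys)

lemma K_keys: "c \<in> K \<Longrightarrow> Poly_Mapping.keys c \<subseteq> carrier M \<times> T"
  using subsetD[OF subgroup.subset[OF K_subgroup]] unfolding carrier_free_Abelian_group_iff .

lemma K_zero: "0 \<in> K"
  using subgroup.one_closed[OF K_subgroup] by simp

lemma K_add: "c \<in> K \<Longrightarrow> d \<in> K \<Longrightarrow> c + d \<in> K"
  using subgroup.m_closed[OF K_subgroup, of c d] by simp

lemma K_uminus: "c \<in> K \<Longrightarrow> - c \<in> K"
  using subgroup.m_inv_closed[OF K_subgroup, of c] K_keys by simp

lemma K_diff: "c \<in> K \<Longrightarrow> d \<in> K \<Longrightarrow> c - d \<in> K"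
  using K_add[OF _ K_uminus, of c d] by simp

lemma K_relators:
  "\<lbrakk>x \<in> carrier M; x' \<in> carrier M; t \<in> T\<rbrakk> \<Longrightarrow>
    frag_of (x \<oplus>\<^bsub>M\<^esub> x', t) - frag_of (x, t) - frag_of (x', t) \<in> K"
  "\<lbrakk>x \<in> carrier M; t \<in> T; t' \<in> T\<rbrakk> \<Longrightarrow>
    frag_of (x, t \<oplus> t') - frag_of (x, t) - frag_of (x, t') \<in> K"
  "\<lbrakk>a \<in> A; x \<in> carrier M; t \<in> T\<rbrakk> \<Longrightarrow> frag_of (a \<odot>\<^bsub>M\<^esub> x, t) - frag_of (x, a \<otimes> t) \<in> K"
  unfolding tensor_kernel_def tensor_relators_def
  by (rule generate.incl, force)+

text \<open>Once \<open>b\<close> is a denominator of the \<open>T\<close>-entries, no dummy value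
  occurs, and the bilinear formula \<open>(b t) x\<close> kills all three kinds of relators.\<close>

lemma scaled_relator:
  assumes c: "c \<in> tensor_relators RA M N"
  shows "\<exists>E. finite E \<and> E \<subseteq> T \<and> (\<forall>b\<in>denominators R A E. scaled M b c = \<zero>\<^bsub>M\<^esub>)"
proof -
  have cancel: "(p \<oplus>\<^bsub>M\<^esub> q) \<ominus>\<^bsub>M\<^esub> p \<ominus>\<^bsub>M\<^esub> q = \<zero>\<^bsub>M\<^esub>"
    if "p \<in> carrier M" "q \<in> carrier M" for p q
  proof -
    have "(p \<oplus>\<^bsub>M\<^esub> q) \<ominus>\<^bsub>M\<^esub> p \<ominus>\<^bsub>M\<^esub> q = (p \<oplus>\<^bsub>M\<^esub> q) \<oplus>\<^bsub>M\<^esub> \<ominus>\<^bsub>M\<^esub> (p \<oplus>\<^bsub>M\<^esub> q)"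
      using that by (simp add: a_minus_def M.minus_add M.a_assoc)
    then show ?thesis using that by (simp add: M.r_neg)
  qed
  have keys: "Poly_Mapping.keys (frag_of (x, t)) \<subseteq> carrier M \<times> T" if "x \<in> carrier M" "t \<in> T" for x t
    using that by simp
  from c show ?thesis
  proof (cases rule: relator_cases)
    case (add_left x x' y)
    have "scaled M b c = \<zero>\<^bsub>M\<^esub>" if "b \<in> denominators R A {y}" for b
    proof -
      have "b \<otimes> y \<in> A" using that by (simp add: denominators_def)
      then show ?thesis
        using add_left cancel M.smult_closed
        by (simp add: scaled_diff keys keys_diff_subset scaled_frag_of M.smult_r_distr)
    qed
    then show ?thesis using add_left by (intro exI[of _ "{y}"]) auto
  next
    case (add_right x y y')
    have "scaled M b c = \<zero>\<^bsub>M\<^esub>" if "b \<in> denominators R A {y, y'}" for b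
    proof -
      have b: "b \<in> A" "b \<otimes> y \<in> A" "b \<otimes> y' \<in> A" using that by (auto simp: denominators_def)
      then have "b \<otimes> (y \<oplus> y') = b \<otimes> y \<oplus> b \<otimes> y'"
        using add_right A_carr T_carr by (simp add: r_distr)
      moreover have "b \<otimes> y \<oplus> b \<otimes> y' \<in> A" using b A_closed(7) by blast
      ultimately show ?thesis
        using add_right cancel b M.smult_closed T_closed(7) M.smult_l_distr[of "b \<otimes> y" "b \<otimes> y'" x]
        by (simp add: scaled_diff keys keys_diff_subset scaled_frag_of)
    qed
    then show ?thesis using add_right by (intro exI[of _ "{y, y'}"]) auto
  next
    case (scalar a x y)
    have "scaled M b c = \<zero>\<^bsub>M\<^esub>" if "b \<in> denominators R A {y}" for b
    proof -
      have b: "b \<in> A" "b \<otimes> y \<in> A" using that by (auto simp: denominators_def)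
      then have "b \<otimes> (a \<otimes> y) = (b \<otimes> y) \<otimes> a"
        using scalar A_carr T_carr by (simp add: m_ac)
      moreover have "(b \<otimes> y) \<otimes> a \<in> A" using b scalar A_closed(6) by blast
      moreover have "a \<otimes> y \<in> T" using scalar A_T T_closed(6) by blast
      ultimately show ?thesis
        using scalar b M.smult_closed M.smult_assoc1[of "b \<otimes> y" a x]
        by (simp add: scaled_diff keys scaled_frag_of a_minus_def M.r_neg)
    qed
    then show ?thesis using scalar by (intro exI[of _ "{y}"]) auto
  qed
qed

text \<open>The finite sets belonging to two kernel elements are united for their sum, since
  denominators of the union serve both.\<close>

lemma kernel_scaled:
  assumes "c \<in> K"
  shows "\<exists>E. finite E \<and> E \<subseteq> T \<and> (\<forall>b\<in>denominators R A E. scaled M b c = \<zero>\<^bsub>M\<^esub>)"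
  using assms unfolding tensor_kernel_def N_simps
proof induction
  case one
  then show ?case by (intro exI[of _ "{}"]) (simp add: scaled_zero)
next
  case (incl h)
  then show ?case by (rule scaled_relator)
next
  case (inv h)
  then obtain E where "finite E" "E \<subseteq> T" "\<forall>b\<in>denominators R A E. scaled M b h = \<zero>\<^bsub>M\<^esub>"
    using scaled_relator by blast
  then show ?case using relator_keys[OF inv]
    by (intro exI[of _ E]) (simp add: scaled_uminus)
next
  case (eng h k)
  then have "h \<in> K" "k \<in> K" by (simp_all add: tensor_kernel_def)
  then have keys: "Poly_Mapping.keys h \<subseteq> carrier M \<times> T" "Poly_Mapping.keys k \<subseteq> carrier M \<times> T"
    using K_keys by blast+
  from eng obtain E E' where
    "finite E" "E \<subseteq> T" "\<And>b. b \<in> denominators R A E \<Longrightarrow> scaled M b h = \<zero>\<^bsub>M\<^esub>"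
    "finite E'" "E' \<subseteq> T" "\<And>b. b \<in> denominators R A E' \<Longrightarrow> scaled M b k = \<zero>\<^bsub>M\<^esub>"
    by blast
  then show ?case using keys
    by (intro exI[of _ "E \<union> E'"]) (auto simp: scaled_add denominators_def)
qed

lemma frag_of_zero_K:
  assumes "t \<in> T"
  shows "frag_of (\<zero>\<^bsub>M\<^esub>, t) \<in> K"
proof -
  \<comment> \<open>The relator for 0 + 0 = 0 is the negative of the wanted generator.\<close>
  have "frag_of (\<zero>\<^bsub>M\<^esub>, t) - frag_of (\<zero>\<^bsub>M\<^esub>, t) - frag_of (\<zero>\<^bsub>M\<^esub>, t) \<in> K"
    using K_relators(1)[OF M.zero_closed M.zero_closed assms] by simp
  from K_uminus[OF this] show ?thesis by simp
qed

lemma shift_add_K: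
  assumes r: "r \<in> T" "r' \<in> T" and c: "Poly_Mapping.keys c \<subseteq> carrier M \<times> T"
  shows "shift (r \<oplus> r') c - shift r c - shift r' c \<in> K"
  using c
proof (induction c rule: free_Abelian_group_induct[consumes 1, case_names zero diff frag_of])
  case zero
  then show ?case using K_zero by (simp add: shift_def)
next
  case (diff x y)
  then show ?case using K_diff[OF diff(3,4)] by (simp add: shift_def frag_extend_diff algebra_simps)
next
  case (frag_of a)
  then show ?case
    using r K_relators(2)[of "fst a" "r \<otimes> snd a" "r' \<otimes> snd a"] T_closed(6) T_carr
    by (auto simp: shift_def l_distr)
qed

text \<open>As \<open>b t\<close> is a scalar from \<open>A\<close>, the tensors of \<open>x\<close>
  with \<open>s b t\<close> and of \<open>(b t) x\<close> with \<open>s\<close> agree. So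
  multiplication by \<open>s b\<close> factors through \<open>scaled M b\<close>.\<close>

lemma shift_denominator_K:
  assumes s: "s \<in> T" and b: "b \<in> A"
    and c: "Poly_Mapping.keys c \<subseteq> {(x, t). x \<in> carrier M \<and> t \<in> T \<and> b \<otimes> t \<in> A}"
  shows "shift (s \<otimes> b) c - frag_of (scaled M b c, s) \<in> K"
  using c
proof (induction c rule: free_Abelian_group_induct[consumes 1, case_names zero diff frag_of])
  case zero
  then show ?case using K_uminus[OF frag_of_zero_K[OF s]] by (simp add: shift_def scaled_zero)
next
  case (diff c d)
  have keys: "Poly_Mapping.keys c \<subseteq> carrier M \<times> T" "Poly_Mapping.keys d \<subseteq> carrier M \<times> T"
    using diff by auto
  define p q where "p = scaled M b c" and "q = scaled M b d"
  have pq: "p \<in> carrier M" "q \<in> carrier M" using keys scaled_closed by (auto simp: p_def q_def)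
  have "(p \<ominus>\<^bsub>M\<^esub> q) \<oplus>\<^bsub>M\<^esub> q = p" using pq by (simp add: a_minus_def M.a_assoc M.l_neg)
  then have "frag_of (p, s) - frag_of (p \<ominus>\<^bsub>M\<^esub> q, s) - frag_of (q, s) \<in> K"
    using K_relators(1)[of "p \<ominus>\<^bsub>M\<^esub> q" q s] pq s by simp
  from K_add[OF K_diff[OF diff(3,4)] this]
  show ?case using keys
    by (simp add: shift_def frag_extend_diff scaled_diff p_def q_def algebra_simps)
next
  case (frag_of a)
  then obtain x t where a: "a = (x, t)" "x \<in> carrier M" "t \<in> T" "b \<otimes> t \<in> A" by auto
  then have "s \<otimes> b \<otimes> t = (b \<otimes> t) \<otimes> s" using s b A_carr T_carr by (simp add: m_ac)
  then show ?case
    using a s K_uminus[OF K_relators(3)[of "b \<otimes> t" x s]] by (simp add: shift_def scaled_frag_of)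
qed

text \<open>Converse to \<open>kernel_scaled\<close>: common denominators of \<open>E\<close> and of
  the entries of \<open>c\<close> multiply \<open>c\<close> into the kernel, so the multipliers
  doing this form an ideal that contains 1.\<close>

lemma scaled_kernel:
  assumes c: "Poly_Mapping.keys c \<subseteq> carrier M \<times> T" and E: "finite E" "E \<subseteq> T"
    and zero: "\<And>b. b \<in> denominators R A E \<Longrightarrow> scaled M b c = \<zero>\<^bsub>M\<^esub>"
  shows "c \<in> K"
proof -
  \<comment> \<open>The extra factor \<open>s\<close> builds stability under \<open>T\<close> into
    \<open>Q\<close>.\<close>
  define Q where "Q = {r \<in> T. \<forall>s\<in>T. shift (s \<otimes> r) c \<in> K}"
  have "ideal Q (R\<lparr>carrier := T\<rparr>)"
  proof (rule ideal_of_subringI[OF T])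
    have "shift \<zero> c \<in> K"
      using K_uminus[OF shift_add_K[OF T_closed(2) T_closed(2) c]] by simp
    then show "Q \<subseteq> T" "\<zero> \<in> Q" using T_closed(2) T_carr by (auto simp: Q_def)
  next
    fix u v assume uv: "u \<in> Q" "v \<in> Q"
    have "shift (s \<otimes> (u \<oplus> v)) c \<in> K" if s: "s \<in> T" for s
    proof -
      have *: "s \<otimes> u \<in> T" "s \<otimes> v \<in> T" "shift (s \<otimes> u) c \<in> K" "shift (s \<otimes> v) c \<in> K"
        using uv s T_closed(6) by (auto simp: Q_def)
      have "s \<otimes> (u \<oplus> v) = s \<otimes> u \<oplus> s \<otimes> v"
        using uv s T_carr by (auto simp: Q_def r_distr)
      then show ?thesis
        using K_add[OF K_add[OF shift_add_K[OF *(1,2) c] *(3)] *(4)] by simp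
    qed
    then show "u \<oplus> v \<in> Q" using uv T_closed(7) by (auto simp: Q_def)
  next
    fix b u assume bu: "b \<in> T" "u \<in> Q"
    have "shift (s \<otimes> (b \<otimes> u)) c \<in> K" if s: "s \<in> T" for s
    proof -
      have "s \<otimes> (b \<otimes> u) = (s \<otimes> b) \<otimes> u" using bu s T_carr by (auto simp: Q_def m_assoc)
      then show ?thesis using bu s T_closed(6) by (auto simp: Q_def)
    qed
    then show "b \<otimes> u \<in> Q" using bu T_closed(6) by (auto simp: Q_def)
  qed
  moreover have "denominators R A (E \<union> snd ` Poly_Mapping.keys c) \<subseteq> Q"
  proof
    fix b assume b: "b \<in> denominators R A (E \<union> snd ` Poly_Mapping.keys c)"
    then have bA: "b \<in> A" and sc: "scaled M b c = \<zero>\<^bsub>M\<^esub>"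
      using zero by (auto simp: denominators_def)
    have keys: "Poly_Mapping.keys c \<subseteq> {(x, t). x \<in> carrier M \<and> t \<in> T \<and> b \<otimes> t \<in> A}"
      using c b by (force simp: denominators_def)
    have "shift (s \<otimes> b) c \<in> K" if s: "s \<in> T" for s
      using K_add[OF shift_denominator_K[OF s bA keys] frag_of_zero_K[OF s]] sc by simp
    then show "b \<in> Q" using bA A_T by (auto simp: Q_def)
  qed
  moreover have "E \<union> snd ` Poly_Mapping.keys c \<subseteq> T" using E c by force
  ultimately have "\<one> \<in> Q" using E by (intro finite_denominators_unit) auto
  then have "shift (\<one> \<otimes> \<one>) c \<in> K" using T_closed(3) unfolding Q_def by blast
  moreover have "shift (\<one> \<otimes> \<one>) c = frag_extend frag_of c"
    unfolding shift_def using c T_carr by (intro frag_extend_eq) auto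
  ultimately show ?thesis by (simp flip: frag_expansion)
qed

end

text \<open>Both tensor kernels are detected by \<open>scaled\<close>, and \<open>f\<close> commutes
  with it. Injectivity of \<open>f\<close> therefore makes \<open>\<Phi>\<close>, the lift of
  \<open>f \<otimes> id\<close>, reflect the kernel.\<close>

lemma flat: "flat_module TYPE('u) RA N"
  unfolding flat_module_def
proof (intro conjI allI impI module_N)
  fix M M' :: "('a, 'u) module" and f
  assume *: "module RA M \<and> module RA M' \<and> f \<in> module_homs RA M M' \<and> inj_on f (carrier M)"
  then have M: "module RA M" and M': "module RA M'" and inj: "inj_on f (carrier M)" by auto
  interpret M: module RA M by (rule M)
  interpret M': module RA M' by (rule M')
  have f: "\<And>x. x \<in> carrier M \<Longrightarrow> f x \<in> carrier M'"
    "\<And>x y. x \<in> carrier M \<Longrightarrow> y \<in> carrier M \<Longrightarrow> f (x \<oplus>\<^bsub>M\<^esub> y) = f x \<oplus>\<^bsub>M'\<^esub> f y"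
    "\<And>a x. a \<in> A \<Longrightarrow> x \<in> carrier M \<Longrightarrow> f (a \<odot>\<^bsub>M\<^esub> x) = a \<odot>\<^bsub>M'\<^esub> f x"
    using * by (auto simp: module_homs_def)
  interpret f: group_hom "add_monoid M" "add_monoid M'" f
    using f M.add.is_group M'.add.is_group
    by (intro group_hom.intro) (auto simp: group_hom_axioms_def hom_def)
  have f0: "f \<zero>\<^bsub>M\<^esub> = \<zero>\<^bsub>M'\<^esub>" using f.hom_one by simp
  have f_diff: "f (x \<ominus>\<^bsub>M\<^esub> y) = f x \<ominus>\<^bsub>M'\<^esub> f y" if "x \<in> carrier M" "y \<in> carrier M" for x y
    using that f(2)[of x "\<ominus>\<^bsub>M\<^esub> y"] f.hom_inv[of y] by (simp add: a_minus_def a_inv_def)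
  define \<Phi> where "\<Phi> = frag_extend (\<lambda>(x, y :: 'a). frag_of (f x, y))"
  let ?F = "free_Abelian_group (carrier M \<times> T)" and ?F' = "free_Abelian_group (carrier M' \<times> T)"
  let ?K = "tensor_kernel RA M N" and ?K' = "tensor_kernel RA M' N"
  have \<Phi>_keys: "Poly_Mapping.keys (\<Phi> c) \<subseteq> carrier M' \<times> T"
    if "Poly_Mapping.keys c \<subseteq> carrier M \<times> T" for c
  proof
    fix z assume "z \<in> Poly_Mapping.keys (\<Phi> c)"
    then obtain p where p: "p \<in> Poly_Mapping.keys c"
        "z \<in> Poly_Mapping.keys ((\<lambda>(x, y :: 'a). frag_of (f x, y)) p)"
      using subsetD[OF keys_frag_extend] unfolding \<Phi>_def UN_iff by metis
    then have "fst p \<in> carrier M" "snd p \<in> T" "z = (f (fst p), snd p)"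
      using that by (auto split: prod.splits)
    then show "z \<in> carrier M' \<times> T" using f(1) by simp
  qed
  have scaled_\<Phi>: "scaled M' b (\<Phi> c) = f (scaled M b c)"
    if "Poly_Mapping.keys c \<subseteq> carrier M \<times> T" for b c
    using that
  proof (induction c rule: free_Abelian_group_induct[consumes 1, case_names zero diff frag_of])
    case zero
    then show ?case by (simp add: \<Phi>_def scaled_zero[OF M] scaled_zero[OF M'] f0)
  next
    case (diff x y)
    have "\<Phi> (x - y) = \<Phi> x - \<Phi> y" by (simp add: \<Phi>_def frag_extend_diff)
    then show ?case using diff
      by (simp add: scaled_diff[OF M] scaled_diff[OF M'] \<Phi>_keys f_diff scaled_closed[OF M])
  next
    case (frag_of a)
    then show ?case
      using f by (auto simp: \<Phi>_def scaled_frag_of[OF M] scaled_frag_of[OF M'] f0)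
  qed
  have kernel_iff: "\<Phi> c \<in> ?K' \<longleftrightarrow> c \<in> ?K" if c: "Poly_Mapping.keys c \<subseteq> carrier M \<times> T" for c
  proof -
    have "scaled M' b (\<Phi> c) = \<zero>\<^bsub>M'\<^esub> \<longleftrightarrow> scaled M b c = \<zero>\<^bsub>M\<^esub>" for b
      using scaled_\<Phi>[OF c] f0 inj_onD[OF inj, of "scaled M b c" "\<zero>\<^bsub>M\<^esub>"] scaled_closed[OF M c]
      by auto
    then show ?thesis
      using kernel_scaled[OF M] kernel_scaled[OF M'] scaled_kernel[OF M c] 
        scaled_kernel[OF M' \<Phi>_keys[OF c]] by metis
  qed
  note K = K_subgroup[OF M] and K' = K_subgroup[OF M']
  have map_coset: "tensor_map RA M' N f (?K #>\<^bsub>?F\<^esub> c) = ?K' #>\<^bsub>?F'\<^esub> \<Phi> c"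
    if c: "Poly_Mapping.keys c \<subseteq> carrier M \<times> T" for c
  proof -
    \<comment> \<open>All members of a coset have the same image coset, so the union in
      \<open>tensor_map\<close> is that single coset.\<close>
    have "?K' #>\<^bsub>?F'\<^esub> \<Phi> d = ?K' #>\<^bsub>?F'\<^esub> \<Phi> c" if d: "d \<in> ?K #>\<^bsub>?F\<^esub> c" for d
    proof -
      obtain k where k: "k \<in> ?K" "d = k + c" using d by (auto simp: r_coset_def)
      then have "\<Phi> d = \<Phi> k + \<Phi> c" by (simp add: \<Phi>_def frag_extend_add)
      moreover have "\<Phi> k \<in> ?K'" using kernel_iff K_keys[OF M] k by blast
      ultimately have "\<Phi> d \<in> ?K' #>\<^bsub>?F'\<^esub> \<Phi> c" by (auto simp: r_coset_def)
      then show ?thesis using group.repr_independence[OF group_free_Abelian_group _ _ K'] \<Phi>_keys[OF c] by simp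
    qed
    moreover have "c \<in> ?K #>\<^bsub>?F\<^esub> c" using group.rcos_self[OF group_free_Abelian_group _ K] c by simp
    ultimately show ?thesis
      unfolding tensor_map_def N_simps \<Phi>_def[symmetric] by blast
  qed
  show "inj_on (tensor_map RA M' N f) (carrier (tensor_product RA M N))"
  proof (rule inj_onI)
    fix V W
    assume "V \<in> carrier (tensor_product RA M N)" "W \<in> carrier (tensor_product RA M N)"
      and eq: "tensor_map RA M' N f V = tensor_map RA M' N f W"
    then obtain c d where c: "V = ?K #>\<^bsub>?F\<^esub> c" "Poly_Mapping.keys c \<subseteq> carrier M \<times> T"
      and d: "W = ?K #>\<^bsub>?F\<^esub> d" "Poly_Mapping.keys d \<subseteq> carrier M \<times> T"
      unfolding tensor_product_def FactGroup_def RCOSETS_def by auto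
    have "?K' #>\<^bsub>?F'\<^esub> \<Phi> c = ?K' #>\<^bsub>?F'\<^esub> \<Phi> d"
      using eq map_coset c d by simp
    then have "\<Phi> c \<in> ?K' #>\<^bsub>?F'\<^esub> \<Phi> d"
      using group.rcos_self[OF group_free_Abelian_group _ K', of "\<Phi> c"] \<Phi>_keys[OF c(2)] by simp
    then obtain k where k: "k \<in> ?K'" "\<Phi> c = k + \<Phi> d" by (auto simp: r_coset_def)
    then have "\<Phi> (c - d) = k" by (simp add: \<Phi>_def frag_extend_diff)
    moreover have "Poly_Mapping.keys (c - d) \<subseteq> carrier M \<times> T"
      using keys_diff[of c d] c d by blast
    ultimately have "c - d \<in> ?K" using kernel_iff k by blast
    then have "c \<in> ?K #>\<^bsub>?F\<^esub> d" by (force simp: r_coset_def)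
    then show "V = W" using group.repr_independence[OF group_free_Abelian_group _ _ K, of c d] c d by simp
  qed
qed

end

section \<open>The support of the extension\<close>

context cring
begin

text \<open>If no \<open>(A : s)\<close> lay inside \<open>P\<close>, every coset modulo
  \<open>A\<close> would be killed by an element outside \<open>P\<close>, and localizing at
  \<open>P\<close> would leave a single fraction.\<close>

lemma extension_support_witness:
  assumes A: "subring A R" and P: "P \<in> extension_support R A"
  shows "primeideal P (R\<lparr>carrier := A\<rparr>)" and "\<exists>s\<in>carrier R. denominators R A {s} \<subseteq> P"
proof -
  note A' = subringE[OF A]
  let ?M = "quotient_module (ring_as_module R) A"
  let ?U = "A - P"
  let ?L = "localized_module (R\<lparr>carrier := A\<rparr>) ?U ?M"
  show prime: "primeideal P (R\<lparr>carrier := A\<rparr>)"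
    using P by (simp add: extension_support_def module_support_def Spec_def)
  interpret P: primeideal P "R\<lparr>carrier := A\<rparr>" by (rule prime)
  have nontrivial: "carrier ?L \<noteq> {\<zero>\<^bsub>?L\<^esub>}"
    using P by (simp add: extension_support_def module_support_def)
  show "\<exists>s\<in>carrier R. denominators R A {s} \<subseteq> P"
  proof (rule ccontr)
    assume "\<not> (\<exists>s\<in>carrier R. denominators R A {s} \<subseteq> P)"
    then have kill: "\<exists>b\<in>?U. b \<otimes> s \<in> A" if "s \<in> carrier R" for s
      using that by (auto simp: denominators_def)
    have coset: "A +>\<^bsub>ring_as_module R\<^esub> x = A +> x" for x
      by (simp add: a_r_coset_def' ring_as_module_def)
    have coset_add: "A +> (k \<oplus> z) = A +> z" if k: "k \<in> A" and z: "z \<in> carrier R" for k z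
    proof -
      have "h \<oplus> (k \<oplus> z) = (h \<oplus> k) \<oplus> z" "h \<oplus> z = (h \<ominus> k) \<oplus> (k \<oplus> z)" if "h \<in> A" for h
        using subsetD[OF A'(1) that] subsetD[OF A'(1) k] z by algebra+
      moreover have "h \<oplus> k \<in> A" "h \<ominus> k \<in> A" if "h \<in> A" for h
        using A'(5,7) that k by (auto simp: a_minus_def)
      ultimately show ?thesis unfolding a_r_coset_def' by blast
    qed
    have coset_mem: "A +> z = A" if "z \<in> A" for z
    proof -
      have "A +> \<zero> = A" using subsetD[OF A'(1)] by (auto simp: a_r_coset_def')
      then show ?thesis using coset_add[OF that, of \<zero>] subsetD[OF A'(1) that] by simp
    qed
    have carrier_M: "carrier ?M = {A +> x | x. x \<in> carrier R}"
      by (auto simp: quotient_module_def A_RCOSETS_def' coset)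
        (auto simp: ring_as_module_def)
    have smult_M: "r \<odot>\<^bsub>?M\<^esub> (A +> x) = A +> (r \<otimes> x)" if r: "r \<in> A" and x: "x \<in> carrier R" for r x
    proof -
      have "A +> (r \<otimes> y) = A +> (r \<otimes> x)" if y: "y \<in> A +> x" for y
      proof -
        obtain h where h: "h \<in> A" "y = h \<oplus> x" using y by (auto simp: a_r_coset_def')
        then have "r \<otimes> y = r \<otimes> h \<oplus> r \<otimes> x"
          using r x subsetD[OF A'(1)] by (simp add: r_distr)
        then show ?thesis using coset_add[of "r \<otimes> h" "r \<otimes> x"] h r x subsetD[OF A'(1)] A'(6) by simp
      qed
      moreover have "A +> x \<noteq> {}" using A'(2) by (auto simp: a_r_coset_def')
      ultimately have "(\<Union>y\<in>A +> x. A +> (r \<otimes> y)) = A +> (r \<otimes> x)" by blast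
      then show ?thesis by (simp add: quotient_module_def coset) (simp add: ring_as_module_def)
    qed
    have U_mult: "b \<otimes> c \<in> ?U" if "b \<in> ?U" "c \<in> ?U" for b c
      using P.I_prime[of b c] that A'(6) by auto
    have rel: "localization_rel ?U ?M = (carrier ?M \<times> ?U) \<times> (carrier ?M \<times> ?U)"
    proof -
      have "\<exists>u\<in>?U. u \<odot>\<^bsub>?M\<^esub> (t \<odot>\<^bsub>?M\<^esub> m) = u \<odot>\<^bsub>?M\<^esub> (s \<odot>\<^bsub>?M\<^esub> n)"
        if mn: "m \<in> carrier ?M" "n \<in> carrier ?M" and st: "s \<in> ?U" "t \<in> ?U" for m n s t
      proof -
        obtain x y where xy: "m = A +> x" "x \<in> carrier R" "n = A +> y" "y \<in> carrier R"
          using mn by (auto simp: carrier_M)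
        have stc: "s \<in> carrier R" "t \<in> carrier R" "s \<in> A" "t \<in> A" using st A'(1) by auto
        obtain b c where b: "b \<in> ?U" "b \<otimes> (t \<otimes> x) \<in> A" and c: "c \<in> ?U" "c \<otimes> (s \<otimes> y) \<in> A"
          using kill[of "t \<otimes> x"] kill[of "s \<otimes> y"] xy stc by auto
        \<comment> \<open>The product serves as one multiplier for both numerators and stays outside
          the prime \<open>P\<close>.\<close>
        have bc: "b \<otimes> c \<in> ?U" using U_mult b c by blast
        have carr: "b \<in> carrier R" "c \<in> carrier R" using b c A'(1) by auto
        have "(b \<otimes> c) \<otimes> (t \<otimes> x) = c \<otimes> (b \<otimes> (t \<otimes> x))"
          "(b \<otimes> c) \<otimes> (s \<otimes> y) = b \<otimes> (c \<otimes> (s \<otimes> y))"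
          using carr stc xy by algebra+
        then have "(b \<otimes> c) \<otimes> (t \<otimes> x) \<in> A" "(b \<otimes> c) \<otimes> (s \<otimes> y) \<in> A"
          using A'(6) b c by auto
        then have "(b \<otimes> c) \<odot>\<^bsub>?M\<^esub> (t \<odot>\<^bsub>?M\<^esub> m) = (b \<otimes> c) \<odot>\<^bsub>?M\<^esub> (s \<odot>\<^bsub>?M\<^esub> n)"
          using smult_M bc stc xy coset_mem by simp
        then show ?thesis using bc by blast
      qed
      then show ?thesis unfolding localization_rel_def by blast
    qed
    have "A \<in> carrier ?M"
      unfolding carrier_M using coset_mem[OF A'(2)] by blast
    moreover have "\<one> \<in> ?U"
      using P.I_notcarr P.one_imp_carrier A'(3) by auto
    \<comment> \<open>This representative of zero shows that the total relation has exactly one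
      class, the class of zero.\<close>
    ultimately have "(A, \<one>) \<in> carrier ?M \<times> ?U" by simp
    then have "carrier ?L = {carrier ?M \<times> ?U}" and "\<zero>\<^bsub>?L\<^esub> = carrier ?M \<times> ?U"
      unfolding localized_module_def module_fraction_def rel quotient_def
      by (auto simp: quotient_module_def)
    then show False using nontrivial by simp
  qed
qed

text \<open>Each degree costs one factor \<open>r\<close>. If \<open>A[x]\<close> is spanned in
  degrees below \<open>n\<close>, then \<open>r [^] n\<close> multiplies all of \<open>A[x]\<close>
  into \<open>A\<close>.\<close>

lemma poly_values_clear_denominators:
  assumes A: "subring A R" and x: "x \<in> carrier R" and r: "r \<in> A" "r \<otimes> x \<in> A"
    and f: "f \<in> poly_values A x n"
  shows "r [^] n \<otimes> f \<in> A"
  using f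
proof (induction n arbitrary: f)
  case 0
  then show ?case using subringE(2)[OF A] by simp
next
  case (Suc n)
  note A' = subringE[OF A]
  note carr = subsetD[OF A'(1)] subsetD[OF poly_values_carrier[OF A'(1) x]]
  from Suc.prems obtain d g where dg: "f = d \<otimes> x [^] n \<oplus> g" "d \<in> A" "g \<in> poly_values A x n"
    by (auto simp: poly_values_Suc)
  have pow: "(r \<otimes> x) [^] n \<in> A"
    using r by (induction n) (auto simp: A')
  have "x [^] n \<in> carrier R" "r [^] n \<in> carrier R" using x r carr by auto
  then have "r [^] Suc n \<otimes> f = (r \<otimes> d) \<otimes> (r [^] n \<otimes> x [^] n) \<oplus> r \<otimes> (r [^] n \<otimes> g)"
    unfolding nat_pow_Suc using dg r(1) carr by algebra
  also have "r [^] n \<otimes> x [^] n = (r \<otimes> x) [^] n" using r x carr by (simp add: nat_pow_distrib)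
  finally show ?case using pow Suc.IH[OF dg(3)] r dg A'(6,7) by simp
qed

end

text \<open>\<open>m_nonunit\<close> says that 1 is not in \<open>P + mA\<close>, so
  \<open>m\<close> witnesses that \<open>P\<close> is not maximal; \<open>s\<close> witnesses that
  \<open>P\<close> is in the support.\<close>

locale nonmaximal_support = cring R for R (structure) +
  fixes A P :: "'a set" and m s :: 'a
  assumes A: "subring A R" and length_2: "extension_length R A = 2"
    and prime: "primeideal P (R\<lparr>carrier := A\<rparr>)"
    and m: "m \<in> A" "m \<notin> P" and m_nonunit: "\<And>y. y \<in> A \<Longrightarrow> \<one> \<ominus> m \<otimes> y \<notin> P"
    and s: "s \<in> carrier R" "denominators R A {s} \<subseteq> P"
begin

lemmas A' = subringE[OF A]
lemmas A_carr = subsetD[OF A'(1)]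

lemma one_not_P: "\<one> \<notin> P"
  using m_nonunit[OF A'(2)] A_carr[OF m(1)] by (simp add: a_minus_def)

lemma P_mult: "\<lbrakk>b \<in> A; c \<in> A; b \<notin> P; c \<notin> P\<rbrakk> \<Longrightarrow> b \<otimes> c \<notin> P"
  using primeideal.I_prime[OF prime, of b c] by auto

lemma A_pow: "b \<in> A \<Longrightarrow> b [^] (n :: nat) \<in> A"
  by (induction n) (auto simp: A')

lemma P_pow: "\<lbrakk>b \<in> A; b \<notin> P\<rbrakk> \<Longrightarrow> b [^] (n :: nat) \<notin> P"
  by (induction n) (auto simp: one_not_P P_mult A_pow)

lemma m_unit: "y \<in> A \<Longrightarrow> \<one> \<ominus> m \<otimes> y \<in> A"
  using A' m by (simp add: a_minus_def)

lemma no_long_chain: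
  assumes "B1 \<in> intermediate_rings R A" "B2 \<in> intermediate_rings R A"
    "A \<subset> B1" "B1 \<subset> B2" "B2 \<subset> carrier R"
  shows False
proof -
  define C where "C i = (if i = 0 then A else if i = 1 then B1 else if i = 2 then B2 else carrier R)"
    for i :: nat
  have "C i \<in> intermediate_rings R A" for i
    using assms A A' carrier_is_subring by (auto simp: C_def intermediate_rings_def)
  moreover have "C i \<subset> C (Suc i)" if i: "i < 3" for i
  proof -
    consider "i = 0" | "i = 1" | "i = 2" using i by linarith
    then show ?thesis by cases (use assms in \<open>auto simp: C_def\<close>)
  qed
  ultimately have "enat 3 \<le> extension_length R A"
    by (rule chain_le_extension_length[where C = C])
  then show False using length_2 by (simp add: numeral_eq_enat)
qed

text \<open>The preimage of \<open>A\<^sub>P\<close>, i.e. the largest intermediate ring \<open>T\<close> with \<open>T\<^sub>P = A\<^sub>P\<close>.\<close>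

definition local_part :: "'a set" where
  "local_part = {t \<in> carrier R. \<exists>b\<in>A. b \<notin> P \<and> b \<otimes> t \<in> A}"

lemma local_partI: "\<lbrakk>t \<in> carrier R; b \<in> A; b \<notin> P; b \<otimes> t \<in> A\<rbrakk> \<Longrightarrow> t \<in> local_part"
  by (auto simp: local_part_def)

lemma A_local_part: "A \<subseteq> local_part"
  using A' one_not_P A_carr by (auto intro!: local_partI[of _ \<one>])

lemma s_local_part: "s \<notin> local_part"
  using s by (auto simp: local_part_def denominators_def)

lemma subring_local_part: "subring local_part R"
proof (rule subringI)
  fix t t' assume "t \<in> local_part" "t' \<in> local_part"
  then obtain b b' where
    b: "t \<in> carrier R" "b \<in> A" "b \<notin> P" "b \<otimes> t \<in> A" and
    b': "t' \<in> carrier R" "b' \<in> A" "b' \<notin> P" "b' \<otimes> t' \<in> A"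
    by (auto simp: local_part_def)
  have bb': "b \<otimes> b' \<in> A" "b \<otimes> b' \<notin> P" using P_mult b b' A' by auto
  have "(b \<otimes> b') \<otimes> (t \<otimes> t') = (b \<otimes> t) \<otimes> (b' \<otimes> t')"
    "(b \<otimes> b') \<otimes> (t \<oplus> t') = b' \<otimes> (b \<otimes> t) \<oplus> b \<otimes> (b' \<otimes> t')"
    using A_carr[OF b(2)] A_carr[OF b'(2)] b b' by algebra+
  then have "(b \<otimes> b') \<otimes> (t \<otimes> t') \<in> A" "(b \<otimes> b') \<otimes> (t \<oplus> t') \<in> A"
    using b b' A'(6,7) by auto
  then show "t \<otimes> t' \<in> local_part" "t \<oplus> t' \<in> local_part"
    using bb' b b' by (auto intro!: local_partI[of _ "b \<otimes> b'"])
next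
  fix t assume "t \<in> local_part"
  then obtain b where b: "t \<in> carrier R" "b \<in> A" "b \<notin> P" "b \<otimes> t \<in> A"
    by (auto simp: local_part_def)
  then have "b \<otimes> (\<ominus> t) \<in> A" using A'(5) A_carr by (simp add: r_minus)
  then show "\<ominus> t \<in> local_part" using b by (intro local_partI) auto
qed (use A_local_part A' in \<open>auto simp: local_part_def\<close>)

lemma local_part_saturated:
  assumes "z \<in> carrier R" "c \<in> A" "c \<notin> P" "c \<otimes> z \<in> local_part"
  shows "z \<in> local_part"
proof -
  obtain b where b: "b \<in> A" "b \<notin> P" "b \<otimes> (c \<otimes> z) \<in> A"
    using assms by (auto simp: local_part_def)
  then have "(b \<otimes> c) \<otimes> z \<in> A" using assms A_carr by (simp add: m_assoc)
  then show ?thesis using b assms P_mult A'(6) by (intro local_partI[of z "b \<otimes> c"]) auto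
qed

section \<open>The three intermediate rings\<close>

lemma finite_length: "extension_length R A \<noteq> \<infinity>"
  using length_2 by (simp add: numeral_eq_enat)

text \<open>\<open>m\<close> and all \<open>1 - m y\<close> lie outside \<open>P\<close>, so an
  element of \<open>B\<close> that one of them multiplies into \<open>A\<close> is in
  \<open>local_part\<close>. Hence \<open>A\<close> is saturated in \<open>B\<close>.\<close>

lemma intermediate_meets_local_part:
  assumes B: "subring B R" "A \<subseteq> B" and meet: "B \<inter> local_part \<subseteq> A"
  shows "B = A"
proof (rule saturated_subring_eq[OF A finite_length B m(1)])
  note B' = subringE[OF B(1)]
  fix z assume z: "z \<in> B"
  then have zc: "z \<in> carrier R" using B' by auto
  show "z \<in> A" if "m \<otimes> z \<in> A"
    using local_partI[OF zc m that] z meet by blast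
  show "z \<in> A" if "y \<in> A" "(\<one> \<ominus> m \<otimes> y) \<otimes> z \<in> A" for y
    using local_partI[OF zc m_unit m_nonunit] that z meet by blast
qed

lemma local_part_intermediate: "local_part \<in> intermediate_rings R A"
  using subring_local_part A_local_part by (simp add: intermediate_rings_def)

lemma local_part_proper: "A \<subset> local_part" "local_part \<subset> carrier R"
proof -
  show "local_part \<subset> carrier R" using s s_local_part by (auto simp: local_part_def)
  have "carrier R \<noteq> A" using s s_local_part A_local_part by auto
  \<comment> \<open>For \<open>B\<close> the whole ring, the preceding lemma rules out
    \<open>local_part = A\<close>.\<close>
  then have "\<not> carrier R \<inter> local_part \<subseteq> A"
    using intermediate_meets_local_part[OF carrier_is_subring A'(1)] by blast
  then show "A \<subset> local_part" using A_local_part by blast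
qed

text \<open>A fourth ring \<open>B\<close> would give a chain of length 3, either through
  \<open>local_part \<subset> B\<close> or through
  \<open>B \<inter> local_part \<subset> local_part\<close>.\<close>

lemma intermediate_rings_eq: "intermediate_rings R A = {A, local_part, carrier R}"
proof
  show "{A, local_part, carrier R} \<subseteq> intermediate_rings R A"
    using local_part_intermediate A A'(1) carrier_is_subring by (auto simp: intermediate_rings_def)
  show "intermediate_rings R A \<subseteq> {A, local_part, carrier R}"
  proof
    fix B assume B: "B \<in> intermediate_rings R A"
    then have B': "subring B R" "A \<subseteq> B" "B \<subseteq> carrier R"
      using subringE(1) by (auto simp: intermediate_rings_def)
    have int: "B \<inter> local_part \<in> intermediate_rings R A"
      using B' A_local_part subring_inter[OF B'(1) subring_local_part]
      by (auto simp: intermediate_rings_def)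
    show "B \<in> {A, local_part, carrier R}"
    proof (rule ccontr)
      assume "B \<notin> {A, local_part, carrier R}"
      then have neq: "B \<noteq> A" "B \<noteq> local_part" "B \<subset> carrier R" using B' by auto
      then have "A \<subset> B \<inter> local_part"
        using intermediate_meets_local_part[OF B'(1,2)] B'(2) A_local_part by blast
      show False
      proof (cases "local_part \<subseteq> B")
        case True
        then show ?thesis
          using no_long_chain[OF local_part_intermediate B local_part_proper(1)] neq by blast
      next
        case False
        then show ?thesis
          using no_long_chain[OF int local_part_intermediate \<open>A \<subset> B \<inter> local_part\<close>]
            local_part_proper(2) by blast
      qed
    qed
  qed
qed

lemma card_intermediate_rings: "card (intermediate_rings R A) = 3"
proof -
  have "A \<noteq> local_part" "A \<noteq> carrier R" "local_part \<noteq> carrier R"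
    using local_part_proper by auto
  then show ?thesis unfolding intermediate_rings_eq by simp
qed

lemma simple_extension_intermediate:
  assumes "x \<in> carrier R"
  shows "simple_extension A x \<in> intermediate_rings R A"
  using simple_extension_subring[OF A assms] simple_extension_incl[OF A'(1) assms]
  by (simp add: intermediate_rings_def)

lemma simple: "simple_ring_extension R A"
proof -
  have "s \<in> simple_extension A s" by (rule simple_extension_mem[OF A s(1)])
  \<comment> \<open>\<open>s\<close> lies outside \<open>local_part\<close>, so \<open>A[s]\<close>
    can only be the top ring.\<close>
  then have "simple_extension A s = carrier R"
    using simple_extension_intermediate[OF s(1)] s_local_part A_local_part
    unfolding intermediate_rings_eq by blast
  then show ?thesis using s(1) by (auto simp: simple_ring_extension_def)
qed

section \<open>Integral closedness and the Pruefer property\<close>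

lemma integrally_closed:
  assumes x: "x \<in> carrier R" and int: "integral_over A x"
  shows "x \<in> A"
proof (rule ccontr)
  assume "x \<notin> A"
  obtain n y where y: "y \<in> A" "(\<one> \<ominus> m \<otimes> y) \<otimes> (m [^] (n :: nat) \<otimes> x) \<in> A"
    using integral_element_descent[OF A finite_length m(1) x int] by blast
  have u: "\<one> \<ominus> m \<otimes> y \<in> A" "\<one> \<ominus> m \<otimes> y \<notin> P" "m [^] n \<in> A" "m [^] n \<notin> P"
    using m_unit m_nonunit y A_pow P_pow m by auto
  then have "((\<one> \<ominus> m \<otimes> y) \<otimes> m [^] n) \<otimes> x \<in> A"
    using y(2) x A_carr by (simp add: m_assoc)
  then have "x \<in> local_part"
    using x u P_mult A'(6) by (intro local_partI[of x "(\<one> \<ominus> m \<otimes> y) \<otimes> m [^] n"]) auto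
  then obtain r where r: "r \<in> A" "r \<notin> P" "r \<otimes> x \<in> A" by (auto simp: local_part_def)
  \<comment> \<open>By the classification, an integral \<open>x\<close> outside \<open>A\<close>
    generates \<open>local_part\<close>, which becomes a finite \<open>A\<close>-module.\<close>
  have "simple_extension A x \<subseteq> local_part"
    by (rule simple_extension_subring_incl[OF subring_local_part A_local_part \<open>x \<in> local_part\<close>])
  moreover have "x \<in> simple_extension A x" by (rule simple_extension_mem[OF A x])
  ultimately have T: "simple_extension A x = local_part"
    using simple_extension_intermediate[OF x] \<open>x \<notin> A\<close> local_part_proper(2)
    unfolding intermediate_rings_eq by blast
  obtain k where k: "x [^] k \<in> poly_values A x k" using int by (auto simp: integral_over_def)
  \<comment> \<open>As \<open>local_part\<close> is spanned by \<open>1, ..., x^(k-1)\<close>, the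
    power \<open>r^k\<close> multiplies it into \<open>A\<close>. So \<open>a t\<close> is
    \<open>m\<close> times an element of \<open>A\<close> for every \<open>t\<close> in
    \<open>local_part\<close>, and \<open>1 - a t\<close> lies in \<open>A\<close> outside
    \<open>P\<close>.\<close>
  define a where "a = m \<otimes> r [^] k"
  have rk: "r [^] k \<in> A" "r [^] k \<notin> P" using A_pow P_pow r by auto
  have a: "a \<in> A" "a \<notin> P" using rk m P_mult A'(6) by (auto simp: a_def)
  have "carrier R = local_part"
  proof (rule saturated_subring_eq[OF subring_local_part])
    show "extension_length R local_part \<noteq> \<infinity>"
      using extension_length_antimono[OF A_local_part, of R] finite_length
      by (metis enat_ord_simps(5))
    show "a \<in> local_part" using a A_local_part by blast
    fix z assume z: "z \<in> carrier R"
    show "z \<in> local_part" if "a \<otimes> z \<in> local_part"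
      by (rule local_part_saturated[OF z a that])
    fix t assume t: "t \<in> local_part" "(\<one> \<ominus> a \<otimes> t) \<otimes> z \<in> local_part"
    have "t \<in> poly_values A x k" using integral_simple_extension[OF A x k] T t by blast
    then have rt: "r [^] k \<otimes> t \<in> A"
      by (rule poly_values_clear_denominators[OF A x r(1,3)])
    have "a \<otimes> t = m \<otimes> (r [^] k \<otimes> t)"
      using A_carr[OF m(1)] A_carr[OF rk(1)] t(1) by (simp add: a_def m_assoc local_part_def)
    then show "z \<in> local_part"
      using local_part_saturated[OF z m_unit[OF rt] m_nonunit[OF rt]] t(2) by simp
  qed (use carrier_is_subring local_part_proper in auto)
  then show False using local_part_proper(2) by blast
qed

text \<open>Integral closedness of \<open>A\<close> in the whole ring lets
  \<open>denominator_ideal_unit\<close> apply inside every intermediate ring.\<close>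

lemma pruefer: "pruefer_extension TYPE('u) R A"
  unfolding pruefer_extension_def
proof
  fix T assume "T \<in> intermediate_rings R A"
  then have T: "subring T R" "A \<subseteq> T" by (auto simp: intermediate_rings_def)
  have "\<one> \<in> J"
    if "t \<in> T" "ideal J (R\<lparr>carrier := T\<rparr>)" "denominators R A {t} \<subseteq> J" for t J
    using denominator_ideal_unit[OF A finite_length T _ that] integrally_closed subringE(1)[OF T(1)]
    by blast
  then interpret denominator_extension R A T
    using A T by (intro denominator_extension.intro denominator_extension_axioms.intro cring_axioms)
  show "flat_module TYPE('u) (R\<lparr>carrier := A\<rparr>) (ring_as_module (R\<lparr>carrier := T\<rparr>)) \<and>
    cring_epimorphism TYPE('u) (R\<lparr>carrier := A\<rparr>) (R\<lparr>carrier := T\<rparr>) (\<lambda>x. x)"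
    using flat epimorphism by blast
qed

end

theorem proposition3p2:
  fixes S :: "('a, 'm) ring_scheme" and R :: "'a set"
  assumes "cring S" and "subring R S" and "R \<noteq> carrier S"
    and "extension_length S R = 2"
    and "card (extension_support S R) = 2"
    and "\<not> extension_support S R \<subseteq> Max_Spec (S\<lparr>carrier := R\<rparr>)"
  shows "pruefer_extension TYPE('u) S R \<and>
    card (intermediate_rings S R) = 3 \<and>
    simple_ring_extension S R"
proof -
  interpret cring S by (rule assms(1))
  let ?R = "S\<lparr>carrier := R\<rparr>"
  note R = subringE[OF assms(2)]
  obtain P where P: "P \<in> extension_support S R" "\<not> maximalideal P ?R"
    using assms(6) by (auto simp: Max_Spec_def)
  note prime = extension_support_witness(1)[OF assms(2) P(1)]
  obtain s where s: "s \<in> carrier S" "denominators S R {s} \<subseteq> P"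
    using extension_support_witness(2)[OF assms(2) P(1)] by blast
  interpret P: primeideal P ?R by (rule prime)
  \<comment> \<open>\<open>P\<close> is not maximal, so some proper ideal lies strictly above it;
    \<open>m\<close> is taken from this ideal, outside \<open>P\<close>.\<close>
  obtain J where J: "ideal J ?R" "P \<subseteq> J" "J \<noteq> P" "J \<noteq> R"
  proof -
    have "J = P \<or> J = R" if "\<not> thesis" "ideal J ?R" "P \<subseteq> J" for J
      using that \<open>\<And>J. \<lbrakk>ideal J ?R; P \<subseteq> J; J \<noteq> P; J \<noteq> R\<rbrakk> \<Longrightarrow> thesis\<close> by blast
    then have "maximalideal P ?R" if "\<not> thesis"
      using that P.I_notcarr P.is_ideal by (intro maximalidealI) auto
    then show thesis using P(2) by blast
  qed
  note J' = ideal_of_subringD[OF J(1)]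
  obtain m where m: "m \<in> J" "m \<notin> P" using J by blast
  \<comment> \<open>\<open>P + mR\<close> stays inside the proper ideal \<open>J\<close>, so it
    cannot contain 1.\<close>
  have "\<one>\<^bsub>S\<^esub> \<ominus>\<^bsub>S\<^esub> m \<otimes>\<^bsub>S\<^esub> y \<notin> P" if y: "y \<in> R" for y
  proof
    assume "\<one>\<^bsub>S\<^esub> \<ominus>\<^bsub>S\<^esub> m \<otimes>\<^bsub>S\<^esub> y \<in> P"
    then have "(\<one>\<^bsub>S\<^esub> \<ominus>\<^bsub>S\<^esub> m \<otimes>\<^bsub>S\<^esub> y) \<oplus>\<^bsub>S\<^esub> y \<otimes>\<^bsub>S\<^esub> m \<in> J"
      using J(2) J'(3,4) m y by blast
    moreover have "(\<one>\<^bsub>S\<^esub> \<ominus>\<^bsub>S\<^esub> m \<otimes>\<^bsub>S\<^esub> y) \<oplus>\<^bsub>S\<^esub> y \<otimes>\<^bsub>S\<^esub> m = \<one>\<^bsub>S\<^esub>"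
      using subsetD[OF R(1) y] subsetD[OF R(1) subsetD[OF J'(1) m(1)]] by algebra
    ultimately show False using ideal.one_imp_carrier[OF J(1)] J(4) by simp
  qed
  then have "nonmaximal_support S R P m s"
    using assms(2,4) prime m J'(1) s
    by (intro nonmaximal_support.intro nonmaximal_support_axioms.intro cring_axioms) auto
  then interpret nonmaximal_support S R P m s .
  show ?thesis using pruefer card_intermediate_rings simple by (intro conjI)
qed

end
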